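(* For every fixed positive integer $r$, as $n\to\infty$, \[ \log s(n,r) \ge \frac{1}{n-r+1}\binom{n}{r}\log\Bigl(\mathrm{e}^{1-r}(n-r+1)(1+o(1))\Bigr). \]
   Context: $s(n,r)$ denotes the number of sparse paving matroids of rank $r$ on the ground set $[n]=\{1,\dots,n\}$; a matroid of rank $r$ is sparse paving if every $r$-subset of the ground set is either a basis or a circuit-hyperplane. $\log$ is the logarithm to base $2$, $\mathrm{e}$ is Euler's number, and $o(1)$ denotes a quantity tending to $0$ as $n\to\infty$ (for fixed $r$). No divisibility conditions on $n$ and $r$ are assumed. *)

theory Defs
  imports Complex_Main
begin

definition matroid_bases :: "'a set \<Rightarrow> 'a set set \<Rightarrow> bool" where
  "matroid_bases E \<B> \<longleftrightarrow> finite E \<and> \<B> \<noteq> {} \<and> (\<forall>B\<in>\<B>. B \<subseteq> E) \<and>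
     (\<forall>B1\<in>\<B>. \<forall>B2\<in>\<B>. \<forall>x\<in>B1 - B2. \<exists>y\<in>B2 - B1. insert y (B1 - {x}) \<in> \<B>)"

definition indep :: "'a set set \<Rightarrow> 'a set \<Rightarrow> bool" where
  "indep \<B> X \<longleftrightarrow> (\<exists>B\<in>\<B>. X \<subseteq> B)"

definition mrank :: "'a set set \<Rightarrow> 'a set \<Rightarrow> nat" where
  "mrank \<B> X = Max ((\<lambda>B. card (X \<inter> B)) ` \<B>)"

definition circuit :: "'a set \<Rightarrow> 'a set set \<Rightarrow> 'a set \<Rightarrow> bool" where
  "circuit E \<B> C \<longleftrightarrow> C \<subseteq> E \<and> \<not> indep \<B> C \<and> (\<forall>D. D \<subset> C \<longrightarrow> indep \<B> D)"

definition flat :: "'a set \<Rightarrow> 'a set set \<Rightarrow> 'a set \<Rightarrow> bool" where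
  "flat E \<B> F \<longleftrightarrow> F \<subseteq> E \<and> (\<forall>e\<in>E - F. mrank \<B> (insert e F) > mrank \<B> F)"

definition hyperplane :: "'a set \<Rightarrow> 'a set set \<Rightarrow> 'a set \<Rightarrow> bool" where
  "hyperplane E \<B> H \<longleftrightarrow> flat E \<B> H \<and> mrank \<B> H + 1 = mrank \<B> E"

definition sparse_paving :: "'a set \<Rightarrow> nat \<Rightarrow> 'a set set \<Rightarrow> bool" where
  "sparse_paving E r \<B> \<longleftrightarrow> matroid_bases E \<B> \<and> (\<forall>B\<in>\<B>. card B = r) \<and>
     (\<forall>X. X \<subseteq> E \<and> card X = r \<longrightarrow> X \<in> \<B> \<or> (circuit E \<B> X \<and> hyperplane E \<B> X))"

definition s :: "nat \<Rightarrow> nat \<Rightarrow> nat" where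
  "s n r = card {\<B>. sparse_paving {1..n} r \<B>}"

end

theory Submission
  imports Defs "HOL-Analysis.Convex"
begin

text \<open>
  The complement of a family of \<open>r\<close>-sets, no two of which meet in \<open>r - 1\<close> points, is the set of
  bases of a sparse paving matroid. Such families are the matchings of the hypergraph whose vertices
  are the \<open>(r - 1)\<close>-sets and whose edges are the shadows of the \<open>r\<close>-sets; it is \<open>r\<close>-uniform,
  linear and regular of degree \<open>D = n - r + 1\<close> on \<open>N = n choose (r - 1)\<close> vertices.

  Let \<open>Z W\<close> be the number of matchings inside a vertex set \<open>W\<close>. Counting pairs of a matching and
  one of its edges gives \<open>Z W \<ge> (r / |W|) * (\<Sum>e. Z (W - e))\<close>, so by Jensen \<open>ln (Z W)\<close> is at least
  the logarithm of the average degree in \<open>W\<close> plus the average of \<open>ln (Z (W - e))\<close>. In a random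
  greedy matching the degrees should stay close to \<open>\<delta> = D * (|W| / N) ^ (r - 1)\<close>; summing
  \<open>ln \<delta>\<close> over \<open>|W| = N, N - r, \<dots>\<close> gives the main term \<open>(N / r) * (ln D - (r - 1))\<close>.
  The deviation is controlled by the potential \<open>\<Phi> W = (\<Sum>v\<in>W. (deg v - \<delta>)\<^sup>2)\<close>: over the choice of
  \<open>e\<close> its average grows only by a factor \<open>1 + O(1 / |W|)\<close> and an additive \<open>O(D)\<close>. Hence an
  inequality \<open>ln (Z W) \<ge> a - b * \<Phi> W\<close> propagates by induction on \<open>|W|\<close>, without any
  probabilistic concentration: where the potential is large, the right-hand side is negative.
\<close>

section \<open>Real inequalities\<close>

text \<open>Upper companion of Bernoulli's inequality. The induction closes because
  \<open>k + k\<^sup>2 \<le> (k + 1)\<^sup>2\<close> and the cubic term has a favourable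
  sign.\<close>

lemma power_one_minus_le:
  fixes q :: real
  assumes "0 \<le> q" "q \<le> 1"
  shows "(1 - q) ^ k \<le> 1 - real k * q + (real k)\<^sup>2 * q\<^sup>2"
proof (induction k)
  case (Suc k)
  have "(1 - q) ^ Suc k \<le> (1 - q) * (1 - real k * q + (real k)\<^sup>2 * q\<^sup>2)"
    using assms Suc.IH by (simp add: mult_left_mono)
  also have "\<dots> = 1 - real (Suc k) * q + (real k + (real k)\<^sup>2) * q\<^sup>2 - (real k)\<^sup>2 * q ^ 3"
    by (simp add: algebra_simps power2_eq_square power3_eq_cube)
  also have "\<dots> \<le> 1 - real (Suc k) * q + (real (Suc k))\<^sup>2 * q\<^sup>2"
  proof -
    have "(real k + (real k)\<^sup>2) * q\<^sup>2 \<le> (real (Suc k))\<^sup>2 * q\<^sup>2"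
      by (intro mult_right_mono) (auto simp: power2_eq_square algebra_simps)
    moreover have "(real k)\<^sup>2 * q ^ 3 \<ge> 0" using assms by simp
    ultimately show ?thesis by linarith
  qed
  finally show ?case .
qed simp

text \<open>Jensen's inequality for \<open>ln\<close>, from the tangent at the average \<mu>: the
  linear corrections \<open>z e / \<mu> - 1\<close> sum to zero.\<close>

lemma sum_ln_le_ln_average:
  fixes z :: "'a \<Rightarrow> real"
  assumes "finite G" "G \<noteq> {}" "\<And>e. e \<in> G \<Longrightarrow> z e > 0"
  shows "(\<Sum>e\<in>G. ln (z e)) \<le> real (card G) * ln ((\<Sum>e\<in>G. z e) / real (card G))"
proof -
  define \<mu> where "\<mu> = (\<Sum>e\<in>G. z e) / real (card G)"
  have c: "real (card G) > 0" using assms by (simp add: card_gt_0_iff)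
  have \<mu>: "\<mu> > 0" unfolding \<mu>_def using assms c by (intro divide_pos_pos sum_pos) auto
  have "(\<Sum>e\<in>G. ln (z e)) \<le> (\<Sum>e\<in>G. ln \<mu> + (z e / \<mu> - 1))"
  proof (rule sum_mono)
    fix e assume "e \<in> G"
    then have "z e > 0" by (rule assms)
    then have "ln (z e / \<mu>) \<le> z e / \<mu> - 1" using \<mu> by (intro ln_le_minus_one) simp
    then show "ln (z e) \<le> ln \<mu> + (z e / \<mu> - 1)" using \<open>z e > 0\<close> \<mu> by (simp add: ln_div)
  qed
  also have "\<dots> = real (card G) * ln \<mu> + ((\<Sum>e\<in>G. z e) / \<mu> - real (card G))"
    by (simp add: sum.distrib sum_subtractf sum_divide_distrib)
  also have "(\<Sum>e\<in>G. z e) / \<mu> = real (card G)"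
  proof -
    have "(\<Sum>e\<in>G. z e) = \<mu> * real (card G)" using c by (simp add: \<mu>_def)
    then show ?thesis using \<mu> by simp
  qed
  finally show ?thesis by (simp add: \<mu>_def)
qed

text \<open>Here \<open>g\<close> is the drop of the target degree when \<open>m\<close> vertices
  become \<open>m - r\<close>. To first order it is \<open>r * (r - 1) * \<delta> / m\<close>, which
  is what cancels the expected degree loss in the drift. The bounds come from Bernoulli and
  \<open>power_one_minus_le\<close> at \<open>q = r / m\<close>.\<close>

lemma target_degree_step:
  fixes \<delta> m :: real and r :: nat
  assumes "r \<ge> 2" "\<delta> > 0" "m > real r"
  defines "g \<equiv> \<delta> - \<delta> * (1 - real r / m) ^ (r - 1)"
  shows "0 \<le> g" "g \<le> (real r)\<^sup>2 * \<delta> / m"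
    and "\<bar>m * g / real r - (real r - 1) * \<delta>\<bar> \<le> real r ^ 3 * \<delta> / m"
proof -
  define q where "q = real r / m"
  define k where "k = real r - 1"
  have m0: "m > 0" using assms by linarith
  have q: "0 < q" "q < 1" using assms m0 by (auto simp: q_def)
  have k: "0 \<le> k" "k \<le> real r" "real (r - 1) = k" using assms by (auto simp: k_def of_nat_diff)
  have lower: "1 - k * q \<le> (1 - q) ^ (r - 1)"
    using Bernoulli_inequality[of "- q" "r - 1"] q k by simp
  have upper: "(1 - q) ^ (r - 1) \<le> 1 - k * q + k\<^sup>2 * q\<^sup>2"
    using power_one_minus_le[of q "r - 1"] q k by simp
  have g: "g = \<delta> * (1 - (1 - q) ^ (r - 1))" by (simp add: g_def q_def algebra_simps)
  have "(1 - q) ^ (r - 1) \<le> 1" using q by (intro power_le_one) auto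
  then show "0 \<le> g" unfolding g using assms(2) by (intro mult_nonneg_nonneg) auto
  have gu: "g \<le> \<delta> * (k * q)" unfolding g using lower assms by (intro mult_left_mono) auto
  have "k * q \<le> real r * q" using k q by (intro mult_right_mono) auto
  then have "\<delta> * (k * q) \<le> \<delta> * (real r * q)" using assms by (intro mult_left_mono) auto
  then show "g \<le> (real r)\<^sup>2 * \<delta> / m" using gu by (simp add: q_def power2_eq_square mult_ac)
  have gl: "g \<ge> \<delta> * (k * q - k\<^sup>2 * q\<^sup>2)" unfolding g using upper assms by (intro mult_left_mono) auto
  have mq: "m / real r = 1 / q" by (simp add: q_def)
  have "m * g / real r = g / q" using mq by (metis times_divide_eq_left mult.commute mult_1)
  moreover have "g / q \<le> \<delta> * k" using gu q by (simp add: field_simps)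
  moreover have "g / q \<ge> \<delta> * k - \<delta> * (k\<^sup>2 * q)"
    using gl q by (simp add: field_simps power2_eq_square)
  moreover have "\<delta> * (k\<^sup>2 * q) \<le> real r ^ 3 * \<delta> / m"
  proof -
    have "k\<^sup>2 * q \<le> (real r)\<^sup>2 * q" using k q by (intro mult_right_mono power_mono) auto
    then have "\<delta> * (k\<^sup>2 * q) \<le> \<delta> * ((real r)\<^sup>2 * q)" using assms by (intro mult_left_mono) auto
    also have "\<dots> = real r ^ 3 * \<delta> / m" by (simp add: q_def power2_eq_square power3_eq_cube mult_ac)
    finally show ?thesis .
  qed
  ultimately show "\<bar>m * g / real r - (real r - 1) * \<delta>\<bar> \<le> real r ^ 3 * \<delta> / m"
    unfolding k_def[symmetric] by (simp add: abs_le_iff mult.commute[of k])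
qed

text \<open>\<open>r * S\<close> is an antiderivative of the increasing function
  \<open>ln (D * (t / N) ^ (r - 1))\<close>, so over an interval of length \<open>r\<close> it grows
  by at most \<open>r\<close> times the value at the right end. The inequality
  \<open>ln (m / l) \<le> m / l - 1\<close> takes the place of the integral.\<close>

lemma entropy_increment_le:
  fixes m N D :: real and r :: nat
  assumes "r \<ge> 2" "m > real r" "N > 0" "D > 0"
  defines "S \<equiv> \<lambda>t. (t * ln D + (real r - 1) * (t * ln (t / N) - t)) / real r"
  shows "S m - S (m - real r) \<le> ln (D * (m / N) ^ (r - 1))"
proof -
  define l where "l = m - real r"
  have l: "l > 0" and m: "m > 0" using assms by (auto simp: l_def)
  have "ln (m / l) \<le> m / l - 1" using l m by (intro ln_le_minus_one) auto
  then have "l * ln (m / l) \<le> l * (m / l - 1)" using l by (intro mult_left_mono) auto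
  also have "\<dots> = real r" using l by (simp add: l_def field_simps)
  finally have "l * (ln (m / N) - ln (l / N)) \<le> real r"
    using l m assms by (simp add: ln_div)
  then have le: "m * ln (m / N) - m - (l * ln (l / N) - l) \<le> real r * ln (m / N)"
    by (simp add: l_def algebra_simps)
  have "real r * (S m - S l) = real r * ln D + (real r - 1) * (m * ln (m / N) - m - (l * ln (l / N) - l))"
    unfolding S_def using assms(1) by (simp add: l_def field_simps)
  also have "\<dots> \<le> real r * ln D + (real r - 1) * (real r * ln (m / N))"
    using le assms(1) by (intro add_left_mono mult_left_mono) auto
  also have "\<dots> = real r * ln (D * (m / N) ^ (r - 1))"
    using assms m by (simp add: ln_mult ln_realpow of_nat_diff algebra_simps)
  finally show ?thesis using assms(1) by (simp add: l_def)
qed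

text \<open>The logarithm loses at most twice the relative deviation \<open>t\<close>. The
  inequality \<open>2 * t \<le> \<eta> + t\<^sup>2 / \<eta>\<close> trades this for a fixed loss
  \<eta> and a quadratic term, which a potential made of squares can bound.\<close>

lemma ln_ge_of_relative_deviation:
  fixes x \<delta> \<eta> :: real
  assumes "\<delta> > 0" "\<eta> > 0" "\<bar>x\<bar> \<le> \<delta> / 2"
  shows "ln (\<delta> + x) \<ge> ln \<delta> - \<eta> - x\<^sup>2 / (\<delta>\<^sup>2 * \<eta>)"
proof -
  define t where "t = \<bar>x\<bar> / \<delta>"
  have t: "0 \<le> t" "t \<le> 1 / 2" using assms by (auto simp: t_def field_simps)
  have "2 * t \<le> \<eta> + t\<^sup>2 / \<eta>"
    using zero_le_power2[of "\<eta> - t"] assms unfolding power2_diff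
    by (simp add: field_simps power2_eq_square)
  moreover have "ln (1 - t) \<ge> - 2 * t"
  proof -
    have "- t - 2 * t\<^sup>2 \<le> ln (1 - t)" using t by (intro ln_one_minus_pos_lower_bound) auto
    moreover have "2 * t\<^sup>2 \<le> t" using t mult_right_mono[of t "1/2" t] by (simp add: power2_eq_square)
    ultimately show ?thesis by linarith
  qed
  moreover have "ln \<delta> + ln (1 - t) \<le> ln (\<delta> + x)"
  proof -
    have "ln \<delta> + ln (1 - t) = ln (\<delta> * (1 - t))" using assms t by (simp add: ln_mult)
    also have "\<delta> * (1 - t) = \<delta> - \<bar>x\<bar>" using assms by (simp add: t_def algebra_simps)
    also have "ln (\<delta> - \<bar>x\<bar>) \<le> ln (\<delta> + x)"
      using assms by (subst ln_le_cancel_iff) auto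
    finally show ?thesis .
  qed
  moreover have "t\<^sup>2 / \<eta> = x\<^sup>2 / (\<delta>\<^sup>2 * \<eta>)" by (simp add: t_def power_divide)
  ultimately show ?thesis by linarith
qed

lemma powr_neg_times_ln_tendsto_0:
  fixes a :: real
  assumes "a > 0"
  shows "((\<lambda>x. x powr (- a) * ln x) \<longlongrightarrow> 0) at_top"
proof (rule tendsto_sandwich)
  show "\<forall>\<^sub>F x in at_top. (0::real) \<le> x powr (- a) * ln x"
    using eventually_ge_at_top[of "1::real"] by eventually_elim simp
  show "\<forall>\<^sub>F x in at_top. x powr (- a) * ln x \<le> 2 / a * x powr (- (a / 2))"
    using eventually_ge_at_top[of "1::real"]
  proof eventually_elim
    case (elim x)
    have "x powr (- a) * ln x \<le> x powr (- a) * (x powr (a / 2) / (a / 2))"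
      using elim assms by (intro mult_left_mono ln_powr_bound) auto
    also have "\<dots> = 2 / a * (x powr (- a) * x powr (a / 2))" by simp
    also have "x powr (- a) * x powr (a / 2) = x powr (- (a / 2))"
      by (simp add: powr_add[symmetric] field_simps)
    finally show ?case .
  qed
  have "((\<lambda>x. x powr (- (a / 2))) \<longlongrightarrow> 0) (at_top :: real filter)"
    using assms by (intro tendsto_neg_powr filterlim_ident) auto
  then show "((\<lambda>x. 2 / a * x powr (- (a / 2))) \<longlongrightarrow> 0) at_top"
    by (rule tendsto_mult_right_zero)
qed simp

section \<open>Degrees in linear hypergraphs\<close>

text \<open>The edge set stays fixed while the vertex set shrinks, so deleting the vertices of an
  edge changes one argument only.\<close>

definition matchings :: "'a set set \<Rightarrow> 'a set \<Rightarrow> 'a set set set" where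
  "matchings E U = {M. M \<subseteq> E \<and> \<Union>M \<subseteq> U \<and> pairwise disjnt M}"

definition hdeg :: "'a set set \<Rightarrow> 'a \<Rightarrow> real" where
  "hdeg F v = real (card {f \<in> F. v \<in> f})"

lemma hdeg_sum: "finite F \<Longrightarrow> hdeg F v = (\<Sum>f\<in>F. of_bool (v \<in> f))"
  by (simp add: hdeg_def sum.If_cases of_bool_def Int_def)

lemma hdeg_nonneg [simp]: "hdeg F v \<ge> 0"
  by (simp add: hdeg_def)

locale linear_hypergraph =
  fixes U :: "'a set" and F :: "'a set set" and r :: nat
  assumes finite_U [simp]: "finite U"
    and edge_subset: "\<And>e. e \<in> F \<Longrightarrow> e \<subseteq> U"
    and edge_card: "\<And>e. e \<in> F \<Longrightarrow> card e = r"
    and edge_size: "r \<ge> 2"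
    and linear: "\<And>e f x y. \<lbrakk>e \<in> F; f \<in> F; x \<in> e \<inter> f; y \<in> e \<inter> f; x \<noteq> y\<rbrakk> \<Longrightarrow> e = f"
begin

lemma finite_F [simp]: "finite F"
  using edge_subset by (intro finite_subset[OF _ finite_Pow_iff[THEN iffD2, OF finite_U]]) auto

lemma finite_edge: "e \<in> F \<Longrightarrow> finite e"
  using edge_subset finite_U finite_subset by blast

lemma double_count:
  assumes "F' \<subseteq> F"
  shows "(\<Sum>v\<in>U. a v * hdeg F' v) = (\<Sum>f\<in>F'. \<Sum>v\<in>f. a v)"
proof -
  have fin: "finite F'" using assms finite_F finite_subset by blast
  have "(\<Sum>v\<in>U. a v * hdeg F' v) = (\<Sum>v\<in>U. \<Sum>f\<in>F'. a v * of_bool (v \<in> f))"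
    by (simp add: hdeg_sum[OF fin] sum_distrib_left)
  also have "\<dots> = (\<Sum>f\<in>F'. \<Sum>v\<in>U. a v * of_bool (v \<in> f))"
    by (rule sum.swap)
  also have "\<dots> = (\<Sum>f\<in>F'. \<Sum>v\<in>f. a v)"
  proof (rule sum.cong[OF refl])
    fix f assume "f \<in> F'"
    then have "f \<subseteq> U" using assms edge_subset by blast
    then have "U \<inter> {v. v \<in> f} = f" by blast
    then show "(\<Sum>v\<in>U. a v * of_bool (v \<in> f)) = (\<Sum>v\<in>f. a v)"
      by (simp add: of_bool_def if_distrib sum.If_cases cong: if_cong)
  qed
  finally show ?thesis .
qed

lemma sum_hdeg: "F' \<subseteq> F \<Longrightarrow> (\<Sum>v\<in>U. hdeg F' v) = real r * real (card F')"
  using double_count[of F' "\<lambda>_. 1"] edge_card by (simp add: subset_iff)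

lemma hdeg_mono: "F' \<subseteq> F \<Longrightarrow> hdeg F' v \<le> hdeg F v"
  unfolding hdeg_def by (intro of_nat_mono card_mono) auto

section \<open>Quadratic degree deviation and the removal of high-degree vertices\<close>

text \<open>The potential \<Phi> for the current vertex set \<open>U\<close>, with the target degree
  \<delta> left as a parameter.\<close>

definition dev :: "real \<Rightarrow> real" where
  "dev \<delta> = (\<Sum>v\<in>U. (hdeg F v - \<delta>)\<^sup>2)"

definition bad :: "real \<Rightarrow> 'a set" where
  "bad \<delta> = {v \<in> U. hdeg F v > 2 * \<delta>}"

text \<open>
  Edges through vertices of degree above \<open>2\<delta>\<close> are never selected: otherwise the drift of the potential
  would contain \<open>\<Sum>v. deg v * (deg v - \<delta>)\<^sup>2\<close>, which it does not control when \<open>\<delta>\<close> is much smaller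
  than the initial degree.
\<close>

definition good_edges :: "real \<Rightarrow> 'a set set" where
  "good_edges \<delta> = {f \<in> F. f \<inter> bad \<delta> = {}}"

lemma good_edges_subset: "good_edges \<delta> \<subseteq> F"
  by (auto simp: good_edges_def)

lemma finite_good_edges [simp]: "finite (good_edges \<delta>)"
  using good_edges_subset finite_F finite_subset by blast

lemma bad_subset: "bad \<delta> \<subseteq> U"
  by (auto simp: bad_def)

lemma hdeg_good_edges_bad:
  assumes "v \<in> bad \<delta>"
  shows "hdeg (good_edges \<delta>) v = 0"
proof -
  have "{f \<in> good_edges \<delta>. v \<in> f} = {}" using assms by (auto simp: good_edges_def)
  then show ?thesis by (simp add: hdeg_def)
qed

text \<open>Discarding the edges at bad vertices costs only a factor \<open>O(r)\<close> in the
  potential. Their number is at most the sum of the bad degrees, each below twice its deviation. A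
  vertex that is not bad loses \<open>k v \<le> 2 * \<delta>\<close>, so
  \<open>(k v)\<^sup>2 \<le> 2 * \<delta> * k v\<close>; and \<delta> times a bad deviation is at
  most its square.\<close>

lemma good_degree_deviation:
  assumes "\<delta> > 0"
  shows "(\<Sum>v\<in>U - bad \<delta>. (hdeg (good_edges \<delta>) v - \<delta>)\<^sup>2) + (\<Sum>v\<in>bad \<delta>. (hdeg F v - \<delta>)\<^sup>2)
           \<le> 9 * real r * dev \<delta>"
proof -
  let ?B = "bad \<delta>" and ?G = "good_edges \<delta>"
  define k where "k v = hdeg (F - ?G) v" for v
  have finB: "finite ?B" using bad_subset finite_U finite_subset by blast
  have k: "k v = hdeg F v - hdeg ?G v" for v
  proof -
    have "(\<Sum>f\<in>F. of_bool (v \<in> f)) = (\<Sum>f\<in>F - ?G. of_bool (v \<in> f)) + (\<Sum>f\<in>?G. of_bool (v \<in> f) :: real)"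
      by (rule sum.subset_diff) (auto simp: good_edges_subset)
    then show ?thesis unfolding k_def by (simp add: hdeg_sum)
  qed
  have k0: "k v \<ge> 0" for v by (simp add: k_def)
  have kle: "k v \<le> hdeg F v" for v by (simp add: k)
  have card_bad_edges: "real (card (F - ?G)) \<le> (\<Sum>v\<in>?B. hdeg F v)"
  proof -
    have "F - ?G \<subseteq> (\<Union>v\<in>?B. {f \<in> F. v \<in> f})" by (auto simp: good_edges_def)
    then have "card (F - ?G) \<le> card (\<Union>v\<in>?B. {f \<in> F. v \<in> f})"
      using finB by (intro card_mono) auto
    also have "\<dots> \<le> (\<Sum>v\<in>?B. card {f \<in> F. v \<in> f})"
      using finB by (rule card_UN_le)
    finally have "real (card (F - ?G)) \<le> real (\<Sum>v\<in>?B. card {f \<in> F. v \<in> f})"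
      by (rule of_nat_mono)
    then show ?thesis by (simp add: hdeg_def)
  qed
  have xb: "hdeg F v - \<delta> > \<delta>" if "v \<in> ?B" for v
    using that by (simp add: bad_def)
  have "(\<Sum>v\<in>U. k v) = real r * real (card (F - ?G))"
    unfolding k_def by (rule sum_hdeg) auto
  also have "\<dots> \<le> real r * (\<Sum>v\<in>?B. 2 * (hdeg F v - \<delta>))"
  proof (intro mult_left_mono order_trans[OF card_bad_edges] sum_mono)
    fix v assume "v \<in> ?B" then show "hdeg F v \<le> 2 * (hdeg F v - \<delta>)" using xb[of v] by simp
  qed auto
  finally have ksum: "(\<Sum>v\<in>U. k v) \<le> real r * (\<Sum>v\<in>?B. 2 * (hdeg F v - \<delta>))" .
  have "(\<Sum>v\<in>U - ?B. (k v)\<^sup>2) \<le> (\<Sum>v\<in>U - ?B. 2 * \<delta> * k v)"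
  proof (rule sum_mono)
    fix v assume "v \<in> U - ?B"
    then have "hdeg F v \<le> 2 * \<delta>" by (auto simp: bad_def)
    then have "k v \<le> 2 * \<delta>" using kle[of v] by linarith
    then show "(k v)\<^sup>2 \<le> 2 * \<delta> * k v" using k0[of v] by (simp add: power2_eq_square mult_right_mono)
  qed
  also have "\<dots> \<le> (\<Sum>v\<in>U. 2 * \<delta> * k v)"
    using assms k0 by (intro sum_mono2) auto
  also have "\<dots> = 2 * \<delta> * (\<Sum>v\<in>U. k v)" by (simp add: sum_distrib_left)
  also have "\<dots> \<le> 2 * \<delta> * (real r * (\<Sum>v\<in>?B. 2 * (hdeg F v - \<delta>)))"
    using assms ksum by (intro mult_left_mono) auto
  also have "\<dots> = 4 * real r * (\<Sum>v\<in>?B. \<delta> * (hdeg F v - \<delta>))"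
    by (simp add: sum_distrib_left mult_ac)
  also have "\<dots> \<le> 4 * real r * (\<Sum>v\<in>?B. (hdeg F v - \<delta>)\<^sup>2)"
  proof (intro mult_left_mono sum_mono)
    fix v assume "v \<in> ?B"
    then show "\<delta> * (hdeg F v - \<delta>) \<le> (hdeg F v - \<delta>)\<^sup>2"
      using xb[of v] assms by (simp add: power2_eq_square mult_right_mono)
  qed auto
  finally have k2: "(\<Sum>v\<in>U - ?B. (k v)\<^sup>2) \<le> 4 * real r * (\<Sum>v\<in>?B. (hdeg F v - \<delta>)\<^sup>2)" .
  have "(\<Sum>v\<in>U - ?B. (hdeg ?G v - \<delta>)\<^sup>2) \<le> (\<Sum>v\<in>U - ?B. 2 * (hdeg F v - \<delta>)\<^sup>2 + 2 * (k v)\<^sup>2)"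
  proof (rule sum_mono)
    fix v
    have "hdeg ?G v - \<delta> = (hdeg F v - \<delta>) - k v" by (simp add: k)
    moreover have "(a - b)\<^sup>2 \<le> 2 * a\<^sup>2 + 2 * b\<^sup>2" for a b :: real
      using zero_le_power2[of "a + b"] by (simp add: power2_eq_square algebra_simps)
    ultimately show "(hdeg ?G v - \<delta>)\<^sup>2 \<le> 2 * (hdeg F v - \<delta>)\<^sup>2 + 2 * (k v)\<^sup>2" by metis
  qed
  also have "\<dots> = 2 * (\<Sum>v\<in>U - ?B. (hdeg F v - \<delta>)\<^sup>2) + 2 * (\<Sum>v\<in>U - ?B. (k v)\<^sup>2)"
    by (simp add: sum.distrib sum_distrib_left)
  finally have y2: "(\<Sum>v\<in>U - ?B. (hdeg ?G v - \<delta>)\<^sup>2)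
      \<le> 2 * (\<Sum>v\<in>U - ?B. (hdeg F v - \<delta>)\<^sup>2) + 8 * real r * (\<Sum>v\<in>?B. (hdeg F v - \<delta>)\<^sup>2)"
    using k2 by simp
  have split: "dev \<delta> = (\<Sum>v\<in>U - ?B. (hdeg F v - \<delta>)\<^sup>2) + (\<Sum>v\<in>?B. (hdeg F v - \<delta>)\<^sup>2)"
    unfolding dev_def by (rule sum.subset_diff) (auto simp: bad_subset)
  define p where "p = (\<Sum>v\<in>U - ?B. (hdeg F v - \<delta>)\<^sup>2)"
  define q where "q = (\<Sum>v\<in>?B. (hdeg F v - \<delta>)\<^sup>2)"
  have pq: "p \<ge> 0" "q \<ge> 0" by (auto simp: p_def q_def intro: sum_nonneg)
  have "2 * p \<le> 9 * real r * p" using edge_size pq by (intro mult_right_mono) auto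
  moreover have "(8 * real r + 1) * q \<le> 9 * real r * q"
    using edge_size pq by (intro mult_right_mono) auto
  ultimately have "2 * p + 8 * real r * q + q \<le> 9 * real r * (p + q)"
    by (simp add: algebra_simps)
  then show ?thesis using y2 unfolding split p_def[symmetric] q_def[symmetric] by linarith
qed

text \<open>A bad vertex has good degree zero, and the resulting deviation \<delta> is smaller than
  that of its full degree.\<close>

lemma good_degree_deviation_sum:
  assumes "\<delta> > 0"
  shows "(\<Sum>v\<in>U. (hdeg (good_edges \<delta>) v - \<delta>)\<^sup>2) \<le> 9 * real r * dev \<delta>"
proof -
  have "(\<Sum>v\<in>U. (hdeg (good_edges \<delta>) v - \<delta>)\<^sup>2) =
      (\<Sum>v\<in>U - bad \<delta>. (hdeg (good_edges \<delta>) v - \<delta>)\<^sup>2) + (\<Sum>v\<in>bad \<delta>. (hdeg (good_edges \<delta>) v - \<delta>)\<^sup>2)"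
    by (rule sum.subset_diff) (auto simp: bad_subset)
  also have "(\<Sum>v\<in>bad \<delta>. (hdeg (good_edges \<delta>) v - \<delta>)\<^sup>2) \<le> (\<Sum>v\<in>bad \<delta>. (hdeg F v - \<delta>)\<^sup>2)"
  proof (rule sum_mono)
    fix v assume v: "v \<in> bad \<delta>"
    then have "\<delta> \<le> hdeg F v - \<delta>" by (simp add: bad_def)
    then have "\<delta>\<^sup>2 \<le> (hdeg F v - \<delta>)\<^sup>2" using assms by (intro power_mono) auto
    then show "(hdeg (good_edges \<delta>) v - \<delta>)\<^sup>2 \<le> (hdeg F v - \<delta>)\<^sup>2"
      by (simp add: hdeg_good_edges_bad[OF v])
  qed
  finally show ?thesis using good_degree_deviation[OF assms] by linarith
qed

section \<open>Degree loss when the vertices of an edge are deleted\<close>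

text \<open>The degree that \<open>v\<close> loses when the vertices of \<open>e\<close> are
  deleted, as \<open>hdeg_remove\<close> confirms.\<close>

definition hits :: "'a set \<Rightarrow> 'a \<Rightarrow> real" where
  "hits e v = real (card {f \<in> F. v \<in> f \<and> f \<inter> e \<noteq> {}})"

lemma hits_nonneg [simp]: "hits e v \<ge> 0"
  by (simp add: hits_def)

text \<open>By linearity an edge through a vertex outside \<open>e\<close> meets \<open>e\<close> in
  at most one point, so the indicator of meeting \<open>e\<close> equals the number of common
  points.\<close>

lemma hits_eq_sum:
  assumes "e \<in> F" "v \<notin> e"
  shows "hits e v = (\<Sum>f\<in>{f \<in> F. v \<in> f}. \<Sum>w\<in>f - {v}. of_bool (w \<in> e))"
proof -
  have "(\<Sum>f\<in>{f \<in> F. v \<in> f}. \<Sum>w\<in>f - {v}. of_bool (w \<in> e))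
      = (\<Sum>f\<in>{f \<in> F. v \<in> f}. of_bool (f \<inter> e \<noteq> {}) :: real)"
  proof (rule sum.cong[OF refl])
    fix f assume f: "f \<in> {f \<in> F. v \<in> f}"
    have fin: "finite (f - {v})" using f finite_edge by auto
    have eq: "(f - {v}) \<inter> {w. w \<in> e} = f \<inter> e" using assms by auto
    have "(\<Sum>w\<in>f - {v}. of_bool (w \<in> e)) = real (card (f \<inter> e))"
      using fin by (simp add: of_bool_def sum.If_cases flip: eq)
    moreover have "card (f \<inter> e) = of_bool (f \<inter> e \<noteq> {})"
    proof (cases "f \<inter> e = {}")
      case False
      then obtain w where w: "w \<in> f \<inter> e" by blast
      have "f \<inter> e = {w}"
        using linear[of f e] f assms w by blast
      then show ?thesis by simp
    qed auto
    ultimately show "(\<Sum>w\<in>f - {v}. of_bool (w \<in> e)) = (of_bool (f \<inter> e \<noteq> {}) :: real)" by simp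
  qed
  also have "\<dots> = hits e v"
  proof -
    have "{f \<in> F. v \<in> f} \<inter> {f. f \<inter> e \<noteq> {}} = {f \<in> F. v \<in> f \<and> f \<inter> e \<noteq> {}}" by auto
    then show ?thesis by (simp add: of_bool_def sum.If_cases hits_def)
  qed
  finally show ?thesis ..
qed

text \<open>For \<open>w\<close> on an edge \<open>f\<close> through \<open>v\<close>, the edges of
  \<open>G\<close> through \<open>w\<close> that avoid \<open>v\<close> number
  \<open>hdeg G w\<close>, less one if \<open>f\<close> itself lies in \<open>G\<close>: by
  linearity \<open>f\<close> is the only edge containing both. The corrections add up to the
  subtracted term.\<close>

lemma sum_hits:
  assumes "G \<subseteq> F"
  shows "(\<Sum>e\<in>{e \<in> G. v \<notin> e}. hits e v)
     = (\<Sum>f\<in>{f \<in> F. v \<in> f}. \<Sum>w\<in>f - {v}. hdeg G w) - (real r - 1) * hdeg G v"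
proof -
  have finG: "finite G" using assms finite_F finite_subset by blast
  let ?I = "{f \<in> F. v \<in> f}"
  have "(\<Sum>e\<in>{e \<in> G. v \<notin> e}. hits e v)
      = (\<Sum>e\<in>{e \<in> G. v \<notin> e}. \<Sum>f\<in>?I. \<Sum>w\<in>f - {v}. of_bool (w \<in> e))"
    using assms by (intro sum.cong[OF refl] hits_eq_sum) auto
  also have "\<dots> = (\<Sum>f\<in>?I. \<Sum>e\<in>{e \<in> G. v \<notin> e}. \<Sum>w\<in>f - {v}. of_bool (w \<in> e))"
    by (rule sum.swap)
  also have "\<dots> = (\<Sum>f\<in>?I. \<Sum>w\<in>f - {v}. \<Sum>e\<in>{e \<in> G. v \<notin> e}. of_bool (w \<in> e))"
    by (intro sum.cong[OF refl] sum.swap)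
  also have "\<dots> = (\<Sum>f\<in>?I. \<Sum>w\<in>f - {v}. hdeg G w - of_bool (f \<in> G))"
  proof (intro sum.cong[OF refl])
    fix f w assume f: "f \<in> ?I" and w: "w \<in> f - {v}"
    have "(\<Sum>e\<in>G. of_bool (w \<in> e)) =
        (\<Sum>e\<in>G - {e \<in> G. v \<in> e}. of_bool (w \<in> e)) + (\<Sum>e\<in>{e \<in> G. v \<in> e}. of_bool (w \<in> e) :: real)"
      using finG by (intro sum.subset_diff) auto
    moreover have "G - {e \<in> G. v \<in> e} = {e \<in> G. v \<notin> e}" by auto
    moreover have "(\<Sum>e\<in>{e \<in> G. v \<in> e}. of_bool (w \<in> e) :: real) = of_bool (f \<in> G)"
    proof -
      have "e = f" if "e \<in> G" "v \<in> e" "w \<in> e" for e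
        using linear[of e f v w] that f w assms by blast
      then have "{e \<in> G. v \<in> e} \<inter> {e. w \<in> e} = {f} \<inter> G"
        using f w by blast
      then show ?thesis using finG by (simp add: of_bool_def sum.If_cases)
    qed
    ultimately show "(\<Sum>e\<in>{e \<in> G. v \<notin> e}. of_bool (w \<in> e)) = hdeg G w - of_bool (f \<in> G)"
      by (simp add: hdeg_sum[OF finG])
  qed
  also have "\<dots> = (\<Sum>f\<in>?I. \<Sum>w\<in>f - {v}. hdeg G w) - (\<Sum>f\<in>?I. (real r - 1) * of_bool (f \<in> G))"
  proof -
    have "(\<Sum>w\<in>f - {v}. hdeg G w - of_bool (f \<in> G)) =
       (\<Sum>w\<in>f - {v}. hdeg G w) - (real r - 1) * of_bool (f \<in> G)" if "f \<in> ?I" for f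
    proof -
      have "card (f - {v}) = r - 1" using that edge_card finite_edge by auto
      then show ?thesis using edge_size by (simp add: sum_subtractf of_nat_diff)
    qed
    then show ?thesis by (simp add: sum_subtractf)
  qed
  also have "(\<Sum>f\<in>?I. (real r - 1) * of_bool (f \<in> G)) = (real r - 1) * hdeg G v"
  proof -
    have "?I \<inter> {f. f \<in> G} = {f \<in> G. v \<in> f}" using assms by auto
    then have "(\<Sum>f\<in>?I. of_bool (f \<in> G)) = hdeg G v"
      by (simp add: of_bool_def sum.If_cases hdeg_def)
    then show ?thesis by (simp add: sum_distrib_left[symmetric])
  qed
  finally show ?thesis .
qed

text \<open>Distinct edges through \<open>v\<close> that meet \<open>e\<close> do so in distinct
  points, by linearity.\<close>

lemma hits_le:
  assumes "e \<in> F" "v \<notin> e"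
  shows "hits e v \<le> real r"
proof -
  let ?S = "{f \<in> F. v \<in> f \<and> f \<inter> e \<noteq> {}}"
  define h where "h f = (SOME w. w \<in> f \<inter> e)" for f
  have h: "h f \<in> f \<inter> e" if "f \<in> ?S" for f
    unfolding h_def by (rule someI_ex) (use that in blast)
  have "inj_on h ?S"
  proof (rule inj_onI)
    fix f f' assume *: "f \<in> ?S" "f' \<in> ?S" "h f = h f'"
    have "h f \<in> f" "h f \<in> f'" "h f \<in> e" using h[OF *(1)] h[OF *(2)] *(3) by auto
    then show "f = f'" using linear[of f f' v "h f"] * assms by blast
  qed
  moreover have "h ` ?S \<subseteq> e" using h by blast
  ultimately have "card ?S \<le> card e"
    using card_inj_on_le finite_edge[OF assms(1)] by blast
  then show ?thesis using edge_card assms by (simp add: hits_def)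
qed

text \<open>The pointwise bound \<open>r\<close> makes the square linear, and the sum of the hits is
  \<open>r\<close> times the number of edges meeting \<open>e\<close>. That number is
  \<open>O(\<delta>)\<close> because a good edge has no vertex of degree above
  \<open>2 * \<delta>\<close>.\<close>

lemma sum_hits_square_le:
  assumes "e \<in> good_edges \<delta>" "\<delta> \<ge> 0"
  shows "(\<Sum>v\<in>U - e. (hits e v)\<^sup>2) \<le> 2 * real r ^ 3 * \<delta>"
proof -
  have eF: "e \<in> F" using assms by (simp add: good_edges_def)
  have good: "hdeg F w \<le> 2 * \<delta>" if "w \<in> e" for w
  proof -
    have "w \<in> U" "w \<notin> bad \<delta>" using that assms edge_subset[OF eF] by (auto simp: good_edges_def)
    then show ?thesis by (simp add: bad_def)
  qed
  let ?S = "{f \<in> F. f \<inter> e \<noteq> {}}"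
  have hS: "hits e v = hdeg ?S v" for v
    unfolding hits_def hdeg_def by (rule arg_cong[where f = "\<lambda>A. real (card A)"]) auto
  have "card ?S \<le> card (\<Union>w\<in>e. {f \<in> F. w \<in> f})"
    using finite_edge[OF eF] by (intro card_mono) auto
  also have "\<dots> \<le> (\<Sum>w\<in>e. card {f \<in> F. w \<in> f})"
    using finite_edge[OF eF] by (rule card_UN_le)
  finally have "real (card ?S) \<le> (\<Sum>w\<in>e. hdeg F w)"
    unfolding hdeg_def of_nat_sum[symmetric] by (rule of_nat_mono)
  also have "\<dots> \<le> (\<Sum>w\<in>e. 2 * \<delta>)" using good by (rule sum_mono)
  also have "\<dots> = real r * (2 * \<delta>)" using edge_card[OF eF] by simp
  finally have S: "real (card ?S) \<le> real r * (2 * \<delta>)" .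
  have "(\<Sum>v\<in>U - e. (hits e v)\<^sup>2) \<le> (\<Sum>v\<in>U - e. real r * hits e v)"
    using hits_le[OF eF] by (intro sum_mono) (simp add: power2_eq_square mult_right_mono)
  also have "\<dots> \<le> (\<Sum>v\<in>U. real r * hits e v)"
    by (intro sum_mono2) auto
  also have "\<dots> = real r * (real r * real (card ?S))"
    unfolding hS sum_distrib_left[symmetric] by (subst sum_hdeg) auto
  also have "\<dots> \<le> real r * (real r * (real r * (2 * \<delta>)))"
    using S by (intro mult_left_mono) auto
  also have "\<dots> = 2 * real r ^ 3 * \<delta>" by (simp add: power3_eq_cube)
  finally show ?thesis .
qed

text \<open>Each vertex \<open>w\<close> is counted once for every edge through it and every one of
  the \<open>r - 1\<close> other vertices of that edge.\<close>

lemma sum_neighbour_weights: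
  "(\<Sum>v\<in>U. \<Sum>f\<in>{f \<in> F. v \<in> f}. \<Sum>w\<in>f - {v}. c w) = (real r - 1) * (\<Sum>w\<in>U. c w * hdeg F w)"
proof -
  have "(\<Sum>v\<in>U. \<Sum>f\<in>{f \<in> F. v \<in> f}. \<Sum>w\<in>f - {v}. c w)
      = (\<Sum>f\<in>F. \<Sum>v\<in>{v \<in> U. v \<in> f}. \<Sum>w\<in>f - {v}. c w)"
    by (rule sum.swap_restrict) auto
  also have "\<dots> = (\<Sum>f\<in>F. (real r - 1) * (\<Sum>w\<in>f. c w))"
  proof (rule sum.cong[OF refl])
    fix f assume f: "f \<in> F"
    have "{v \<in> U. v \<in> f} = f" using edge_subset[OF f] by auto
    moreover have "(\<Sum>w\<in>f - {v}. c w) = (\<Sum>w\<in>f. c w) - c v" if "v \<in> f" for v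
      using that finite_edge[OF f] by (simp add: sum_diff1)
    ultimately have "(\<Sum>v\<in>{v \<in> U. v \<in> f}. \<Sum>w\<in>f - {v}. c w) = (\<Sum>v\<in>f. (\<Sum>w\<in>f. c w) - c v)"
      by simp
    also have "\<dots> = (real r - 1) * (\<Sum>w\<in>f. c w)"
      using edge_card[OF f] by (simp add: sum_subtractf algebra_simps)
    finally show "(\<Sum>v\<in>{v \<in> U. v \<in> f}. \<Sum>w\<in>f - {v}. c w) = (real r - 1) * (\<Sum>w\<in>f. c w)" .
  qed
  also have "\<dots> = (real r - 1) * (\<Sum>w\<in>U. c w * hdeg F w)"
    by (simp add: double_count sum_distrib_left)
  finally show ?thesis .
qed

text \<open>Controls the cross terms of the drift, where the deviation of a vertex is multiplied by
  those of its neighbours. Restricting \<open>v\<close> to vertices that are not bad caps the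
  degrees by \<open>2 * \<delta>\<close>; neighbours \<open>w\<close> may be bad and are treated
  separately.\<close>

lemma sum_good_neighbour_weights_le:
  assumes "\<delta> > 0"
  shows "(\<Sum>v\<in>U - bad \<delta>. \<Sum>f\<in>{f \<in> F. v \<in> f}. \<Sum>w\<in>f - {v}.
            (hdeg F v - \<delta>)\<^sup>2 + (hdeg (good_edges \<delta>) w - \<delta>)\<^sup>2) \<le> 20 * (real r)\<^sup>2 * \<delta> * dev \<delta>"
proof -
  let ?x = "\<lambda>v. hdeg F v - \<delta>" and ?y = "\<lambda>v. hdeg (good_edges \<delta>) v - \<delta>" and ?B = "bad \<delta>"
  have dev0: "dev \<delta> \<ge> 0" by (auto simp: dev_def intro: sum_nonneg)
  have r1: "real r - 1 \<ge> 0" using edge_size by simp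
  have good: "hdeg F v \<le> 2 * \<delta>" if "v \<in> U - ?B" for v using that by (auto simp: bad_def)
  have "(\<Sum>v\<in>U - ?B. \<Sum>f\<in>{f \<in> F. v \<in> f}. \<Sum>w\<in>f - {v}. (?x v)\<^sup>2 + (?y w)\<^sup>2)
      = (\<Sum>v\<in>U - ?B. (real r - 1) * hdeg F v * (?x v)\<^sup>2)
        + (\<Sum>v\<in>U - ?B. \<Sum>f\<in>{f \<in> F. v \<in> f}. \<Sum>w\<in>f - {v}. (?y w)\<^sup>2)"
  proof -
    have "(\<Sum>f\<in>{f \<in> F. v \<in> f}. \<Sum>w\<in>f - {v}. (?x v)\<^sup>2) = (real r - 1) * hdeg F v * (?x v)\<^sup>2" for v
    proof -
      have "(\<Sum>f\<in>{f \<in> F. v \<in> f}. \<Sum>w\<in>f - {v}. (?x v)\<^sup>2) = (\<Sum>f\<in>{f \<in> F. v \<in> f}. (real r - 1) * (?x v)\<^sup>2)"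
      proof (rule sum.cong[OF refl])
        fix f assume "f \<in> {f \<in> F. v \<in> f}"
        then have "card (f - {v}) = r - 1" using edge_card finite_edge by auto
        then show "(\<Sum>w\<in>f - {v}. (?x v)\<^sup>2) = (real r - 1) * (?x v)\<^sup>2"
          using edge_size by (simp add: of_nat_diff)
      qed
      then show ?thesis by (simp add: hdeg_def)
    qed
    then show ?thesis by (simp add: sum.distrib)
  qed
  also have "(\<Sum>v\<in>U - ?B. (real r - 1) * hdeg F v * (?x v)\<^sup>2) \<le> (\<Sum>v\<in>U - ?B. (real r - 1) * (2 * \<delta>) * (?x v)\<^sup>2)"
    using good r1 by (intro sum_mono mult_right_mono mult_left_mono) auto
  also have "\<dots> \<le> (\<Sum>v\<in>U. (real r - 1) * (2 * \<delta>) * (?x v)\<^sup>2)"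
    using r1 assms by (intro sum_mono2) auto
  also have "\<dots> = (real r - 1) * (2 * \<delta>) * dev \<delta>" by (simp add: dev_def sum_distrib_left)
  also have "(\<Sum>v\<in>U - ?B. \<Sum>f\<in>{f \<in> F. v \<in> f}. \<Sum>w\<in>f - {v}. (?y w)\<^sup>2)
      \<le> (\<Sum>v\<in>U. \<Sum>f\<in>{f \<in> F. v \<in> f}. \<Sum>w\<in>f - {v}. (?y w)\<^sup>2)"
    by (intro sum_mono2 sum_nonneg) auto
  also have "\<dots> = (real r - 1) * (\<Sum>w\<in>U. (?y w)\<^sup>2 * hdeg F w)"
    by (rule sum_neighbour_weights)
  also have "\<dots> \<le> (real r - 1) * (2 * \<delta> * (9 * real r * dev \<delta>))"
  proof (rule mult_left_mono[OF _ r1])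
    have "(\<Sum>w\<in>U. (?y w)\<^sup>2 * hdeg F w)
        = (\<Sum>w\<in>U - ?B. (?y w)\<^sup>2 * hdeg F w) + (\<Sum>w\<in>?B. (?y w)\<^sup>2 * hdeg F w)"
      by (rule sum.subset_diff) (auto simp: bad_subset)
    also have "(\<Sum>w\<in>U - ?B. (?y w)\<^sup>2 * hdeg F w) \<le> (\<Sum>w\<in>U - ?B. (?y w)\<^sup>2 * (2 * \<delta>))"
      using good by (intro sum_mono mult_left_mono) auto
    also have "(\<Sum>w\<in>?B. (?y w)\<^sup>2 * hdeg F w) \<le> (\<Sum>w\<in>?B. (?x w)\<^sup>2 * (2 * \<delta>))"
    proof (rule sum_mono)
      fix w assume w: "w \<in> ?B"
      then have x: "\<delta> < ?x w" by (simp add: bad_def)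
      \<comment> \<open>At a bad vertex the full degree is the deviation plus \<delta>, hence at
        most twice the deviation, while the good deviation is exactly
        \<open>- \<delta>\<close>.\<close>
      have "\<delta> * hdeg F w \<le> ?x w * (2 * ?x w)" using x assms by (intro mult_mono) auto
      then have "\<delta> * (\<delta> * hdeg F w) \<le> \<delta> * (?x w * (2 * ?x w))" using assms by (intro mult_left_mono) auto
      then show "(?y w)\<^sup>2 * hdeg F w \<le> (?x w)\<^sup>2 * (2 * \<delta>)"
        by (simp add: hdeg_good_edges_bad[OF w] power2_eq_square mult_ac)
    qed
    finally have "(\<Sum>w\<in>U. (?y w)\<^sup>2 * hdeg F w) \<le>
        2 * \<delta> * ((\<Sum>w\<in>U - ?B. (?y w)\<^sup>2) + (\<Sum>w\<in>?B. (?x w)\<^sup>2))"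
      by (simp add: sum_distrib_left sum_distrib_right distrib_left mult_ac)
    also have "\<dots> \<le> 2 * \<delta> * (9 * real r * dev \<delta>)"
      using good_degree_deviation[OF assms] assms by (intro mult_left_mono) auto
    finally show "(\<Sum>w\<in>U. (?y w)\<^sup>2 * hdeg F w) \<le> 2 * \<delta> * (9 * real r * dev \<delta>)" .
  qed
  finally have "(\<Sum>v\<in>U - ?B. \<Sum>f\<in>{f \<in> F. v \<in> f}. \<Sum>w\<in>f - {v}. (?x v)\<^sup>2 + (?y w)\<^sup>2)
      \<le> (real r - 1) * (2 * \<delta>) * dev \<delta> + (real r - 1) * (2 * \<delta> * (9 * real r * dev \<delta>))"
    by simp
  also have "\<dots> = (real r - 1) * (2 + 18 * real r) * (\<delta> * dev \<delta>)" by (simp add: algebra_simps)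
  also have "\<dots> \<le> 20 * (real r)\<^sup>2 * (\<delta> * dev \<delta>)"
  proof (rule mult_right_mono)
    show "(real r - 1) * (2 + 18 * real r) \<le> 20 * (real r)\<^sup>2"
      by (simp add: algebra_simps power2_eq_square)
    show "0 \<le> \<delta> * dev \<delta>" using dev0 assms by simp
  qed
  finally show ?thesis by (simp add: mult_ac)
qed

lemma dev_nonneg: "dev \<delta> \<ge> 0"
  by (auto simp: dev_def intro: sum_nonneg)

text \<open>The left side is the square of the sum of the good-degree deviations, so Cauchy-Schwarz
  applies.\<close>

lemma good_edges_deviation:
  assumes "\<delta> > 0"
  shows "(real r * real (card (good_edges \<delta>)) - real (card U) * \<delta>)\<^sup>2 \<le> real (card U) * (9 * real r * dev \<delta>)"
proof -
  have "real r * real (card (good_edges \<delta>)) - real (card U) * \<delta> = (\<Sum>v\<in>U. 1 * (hdeg (good_edges \<delta>) v - \<delta>))"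
    using sum_hdeg[OF good_edges_subset] by (simp add: sum_subtractf)
  then have "(real r * real (card (good_edges \<delta>)) - real (card U) * \<delta>)\<^sup>2
      \<le> (\<Sum>v\<in>U. 1\<^sup>2) * (\<Sum>v\<in>U. (hdeg (good_edges \<delta>) v - \<delta>)\<^sup>2)"
    by (simp only: Cauchy_Schwarz_ineq_sum)
  also have "\<dots> \<le> real (card U) * (9 * real r * dev \<delta>)"
    using good_degree_deviation_sum[OF assms] by (simp add: mult_left_mono)
  finally show ?thesis .
qed

section \<open>Drift of the potential under one greedy step\<close>

text \<open>Half the first-order change of the potential, summed over all choices of
  \<open>e\<close>. For a bad \<open>v\<close> every good edge avoids \<open>v\<close>, the hits
  only help, and \<open>g\<close> is dominated by the deviation of \<open>v\<close>. For the other
  vertices \<open>sum_hits\<close> gives the loss exactly, and its leading term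
  \<open>(r - 1) * \<delta>\<^sup>2\<close> cancels against \<open>A * g\<close>.\<close>

lemma drift_bound:
  fixes \<delta> g :: real
  defines "m \<equiv> real (card U)" and "A \<equiv> real (card (good_edges \<delta>))"
  assumes \<delta>: "\<delta> > 0" "\<delta> \<le> m"
    and g: "0 \<le> g" "g \<le> (real r)\<^sup>2 * \<delta> / m"
    and g': "\<bar>m * g / real r - (real r - 1) * \<delta>\<bar> \<le> real r ^ 3 * \<delta> / m"
  shows "(\<Sum>v\<in>U. (hdeg F v - \<delta>) * (\<Sum>e\<in>{e \<in> good_edges \<delta>. v \<notin> e}. g - hits e v))
    \<le> A * ((real r)\<^sup>2 * dev \<delta> / m) + 5 / 2 * real r ^ 3 * \<delta> * (m + dev \<delta>) + 15 * (real r)\<^sup>2 * \<delta> * dev \<delta>"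
proof -
  let ?G = "good_edges \<delta>" and ?B = "bad \<delta>" and ?\<Phi> = "dev \<delta>" and ?r = "real r"
  define x where "x v = hdeg F v - \<delta>" for v
  define y where "y v = hdeg ?G v - \<delta>" for v
  define Y where "Y = ?r * A - m * \<delta>"
  define Q where "Q v = (\<Sum>f\<in>{f \<in> F. v \<in> f}. \<Sum>w\<in>f - {v}. (x v)\<^sup>2 + (y w)\<^sup>2)" for v
  define d where "d v = x v * (\<Sum>e\<in>{e \<in> ?G. v \<notin> e}. g - hits e v)" for v
  have m0: "m > 0" using \<delta> by linarith
  have r2: "?r \<ge> 2" using edge_size by simp
  have A0: "A \<ge> 0" by (simp add: A_def)
  have g_le: "g \<le> ?r\<^sup>2"
  proof -
    have "?r\<^sup>2 * \<delta> / m \<le> ?r\<^sup>2 * m / m" using \<delta> m0 by (intro divide_right_mono mult_left_mono) auto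
    then show ?thesis using g m0 by simp
  qed
  have free: "real (card {e \<in> ?G. v \<notin> e}) = A - hdeg ?G v" for v
  proof -
    have "{e \<in> ?G. v \<notin> e} = ?G - {e \<in> ?G. v \<in> e}" by auto
    then have "card {e \<in> ?G. v \<notin> e} = card ?G - card {e \<in> ?G. v \<in> e}"
      by (simp add: card_Diff_subset)
    moreover have "card {e \<in> ?G. v \<in> e} \<le> card ?G" by (intro card_mono) auto
    ultimately show ?thesis by (simp add: A_def hdeg_def of_nat_diff)
  qed
  have bad: "d v \<le> A * (?r\<^sup>2 / m) * (x v)\<^sup>2" if v: "v \<in> ?B" for v
  proof -
    have x: "x v > \<delta>" using v by (simp add: bad_def x_def)
    have "(\<Sum>e\<in>{e \<in> ?G. v \<notin> e}. g - hits e v) \<le> A * g"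
      using free[of v] hdeg_good_edges_bad[OF v] by (simp add: sum_subtractf sum_nonneg)
    also have "\<dots> \<le> A * (?r\<^sup>2 * x v / m)"
      using x A0 m0 by (intro mult_left_mono order_trans[OF g(2)] divide_right_mono) auto
    finally have "d v \<le> x v * (A * (?r\<^sup>2 * x v / m))"
      unfolding d_def using x \<delta> by (intro mult_left_mono) auto
    then show ?thesis by (simp add: power2_eq_square mult_ac)
  qed
  \<comment> \<open>The factor 5 collects 1 from \<open>b1\<close> and 2 each from \<open>b3\<close>
    and \<open>b4\<close>.\<close>
  have good: "d v \<le> (5 * ?r ^ 3 * \<delta> + ?r * \<delta> / m * \<bar>Y\<bar>) * \<bar>x v\<bar> + Q v / 2" if v: "v \<in> U - ?B" for v
  proof -
    define R where "R = (\<Sum>f\<in>{f \<in> F. v \<in> f}. \<Sum>w\<in>f - {v}. y w)"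
    have dv: "hdeg F v \<le> 2 * \<delta>" using v by (auto simp: bad_def)
    have dG: "hdeg ?G v \<le> 2 * \<delta>" using hdeg_mono[OF good_edges_subset[of \<delta>], of v] dv by linarith
    have "(\<Sum>f\<in>{f \<in> F. v \<in> f}. \<Sum>w\<in>f - {v}. hdeg ?G w) = (?r - 1) * \<delta> * hdeg F v + R"
    proof -
      have "(\<Sum>w\<in>f - {v}. hdeg ?G w) = (?r - 1) * \<delta> + (\<Sum>w\<in>f - {v}. y w)"
        if "f \<in> {f \<in> F. v \<in> f}" for f
      proof -
        have "card (f - {v}) = r - 1" using that edge_card finite_edge by auto
        then show ?thesis using edge_size by (simp add: y_def sum_subtractf of_nat_diff)
      qed
      then show ?thesis by (simp add: sum.distrib R_def hdeg_def)
    qed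
    then have hsum: "(\<Sum>e\<in>{e \<in> ?G. v \<notin> e}. hits e v) = (?r - 1) * \<delta> * hdeg F v + R - (?r - 1) * hdeg ?G v"
      using sum_hits[OF good_edges_subset[of \<delta>], of v] by simp
    \<comment> \<open>With \<open>A = (m * \<delta> + Y) / r\<close> and
      \<open>hdeg F v = \<delta> + x v\<close>, three parts remain: a bracket of lower-order errors,
      a term in \<open>(x v)\<^sup>2\<close> whose sign pulls the degree back to its target and
      which is later dropped, and the coupling \<open>R\<close> to the neighbours.\<close>
    have eq: "d v = x v * (\<delta> * (m * g / ?r - (?r - 1) * \<delta>) + Y * g / ?r + (?r - 1) * hdeg ?G v - hdeg ?G v * g)
        - (?r - 1) * \<delta> * (x v)\<^sup>2 - x v * R"
    proof -
      have A: "A = (m * \<delta> + Y) / ?r" using r2 by (simp add: Y_def field_simps)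
      have "d v = x v * ((A - hdeg ?G v) * g - ((?r - 1) * \<delta> * (\<delta> + x v) + R - (?r - 1) * hdeg ?G v))"
        unfolding d_def using hsum free[of v] by (simp add: sum_subtractf x_def)
      also have "\<dots> = x v * (A * g - (?r - 1) * \<delta> * \<delta> + (?r - 1) * hdeg ?G v - hdeg ?G v * g)
          - (?r - 1) * \<delta> * (x v)\<^sup>2 - x v * R"
        by (simp add: algebra_simps power2_eq_square)
      also have "A * g - (?r - 1) * \<delta> * \<delta> = \<delta> * (m * g / ?r - (?r - 1) * \<delta>) + Y * g / ?r"
        unfolding A by (simp add: add_divide_distrib algebra_simps)
      finally show ?thesis .
    qed
    have b1: "\<bar>\<delta> * (m * g / ?r - (?r - 1) * \<delta>)\<bar> \<le> ?r ^ 3 * \<delta>"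
    proof -
      have "\<bar>\<delta> * (m * g / ?r - (?r - 1) * \<delta>)\<bar> = \<delta> * \<bar>m * g / ?r - (?r - 1) * \<delta>\<bar>"
        using \<delta> by (simp add: abs_mult)
      also have "\<dots> \<le> \<delta> * (?r ^ 3 * \<delta> / m)"
        using \<delta> by (intro mult_left_mono g') auto
      also have "\<dots> \<le> \<delta> * (?r ^ 3 * m / m)"
        using \<delta> m0 by (intro mult_left_mono divide_right_mono) auto
      finally show ?thesis using m0 by (simp add: mult_ac)
    qed
    have b2: "\<bar>Y * g / ?r\<bar> \<le> ?r * \<delta> / m * \<bar>Y\<bar>"
    proof -
      have "\<bar>Y * g / ?r\<bar> = \<bar>Y\<bar> * (g / ?r)" using g r2 by (simp add: abs_mult)
      also have "\<dots> \<le> \<bar>Y\<bar> * ((?r\<^sup>2 * \<delta> / m) / ?r)"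
        using g r2 by (intro mult_left_mono divide_right_mono) auto
      also have "\<dots> = ?r * \<delta> / m * \<bar>Y\<bar>" using r2 by (simp add: power2_eq_square)
      finally show ?thesis .
    qed
    have b3: "\<bar>(?r - 1) * hdeg ?G v\<bar> \<le> 2 * ?r ^ 3 * \<delta>"
    proof -
      have "?r - 1 \<le> ?r ^ 3" using self_le_power[of ?r 3] r2 by linarith
      then have "(?r - 1) * hdeg ?G v \<le> ?r ^ 3 * (2 * \<delta>)" using dG r2 by (intro mult_mono) auto
      then show ?thesis using r2 by (simp add: abs_mult)
    qed
    have b4: "\<bar>hdeg ?G v * g\<bar> \<le> 2 * ?r ^ 3 * \<delta>"
    proof -
      have "?r\<^sup>2 \<le> ?r ^ 3" using r2 by (intro power_increasing) auto
      then have "hdeg ?G v * g \<le> (2 * \<delta>) * ?r ^ 3"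
        using dG g(1) g_le \<delta> by (intro mult_mono) auto
      then show ?thesis using g by (simp add: abs_mult mult_ac)
    qed
    have tri: "\<bar>a + b + c - d\<bar> \<le> a' + b' + c' + d'"
      if "\<bar>a\<bar> \<le> a'" "\<bar>b\<bar> \<le> b'" "\<bar>c\<bar> \<le> c'" "\<bar>d\<bar> \<le> d'" for a b c d a' b' c' d' :: real
      using that by linarith
    have "\<bar>\<delta> * (m * g / ?r - (?r - 1) * \<delta>) + Y * g / ?r + (?r - 1) * hdeg ?G v - hdeg ?G v * g\<bar>
        \<le> 5 * ?r ^ 3 * \<delta> + ?r * \<delta> / m * \<bar>Y\<bar>"
      using tri[OF b1 b2 b3 b4] by (simp add: mult_ac)
    then have "\<bar>x v\<bar> * \<bar>\<delta> * (m * g / ?r - (?r - 1) * \<delta>) + Y * g / ?r + (?r - 1) * hdeg ?G v - hdeg ?G v * g\<bar>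
        \<le> \<bar>x v\<bar> * (5 * ?r ^ 3 * \<delta> + ?r * \<delta> / m * \<bar>Y\<bar>)"
      by (rule mult_left_mono) simp
    then have "x v * (\<delta> * (m * g / ?r - (?r - 1) * \<delta>) + Y * g / ?r + (?r - 1) * hdeg ?G v - hdeg ?G v * g)
        \<le> \<bar>x v\<bar> * (5 * ?r ^ 3 * \<delta> + ?r * \<delta> / m * \<bar>Y\<bar>)"
      unfolding abs_mult[symmetric] by linarith
    moreover have "- (x v * R) \<le> Q v / 2"
    proof -
      have "- (x v * R) = (\<Sum>f\<in>{f \<in> F. v \<in> f}. \<Sum>w\<in>f - {v}. - (x v * y w))"
        by (simp add: R_def sum_distrib_left sum_negf)
      also have "\<dots> \<le> (\<Sum>f\<in>{f \<in> F. v \<in> f}. \<Sum>w\<in>f - {v}. ((x v)\<^sup>2 + (y w)\<^sup>2) / 2)"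
      proof (intro sum_mono)
        fix w show "- (x v * y w) \<le> ((x v)\<^sup>2 + (y w)\<^sup>2) / 2"
          using zero_le_power2[of "x v + y w"] unfolding power2_sum by (simp add: field_simps)
      qed
      also have "\<dots> = Q v / 2" by (simp add: Q_def sum_divide_distrib)
      finally show ?thesis .
    qed
    moreover have "(?r - 1) * \<delta> * (x v)\<^sup>2 \<ge> 0" using r2 \<delta> by simp
    ultimately show ?thesis unfolding eq by (simp add: mult.commute)
  qed
  define X where "X = (\<Sum>v\<in>U. \<bar>x v\<bar>)"
  have finB: "finite ?B" using bad_subset finite_U finite_subset by blast
  have "(\<Sum>v\<in>U. d v) = (\<Sum>v\<in>U - ?B. d v) + (\<Sum>v\<in>?B. d v)"
    by (rule sum.subset_diff) (auto simp: bad_subset)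
  also have "(\<Sum>v\<in>U - ?B. d v) \<le> (\<Sum>v\<in>U - ?B. (5 * ?r ^ 3 * \<delta> + ?r * \<delta> / m * \<bar>Y\<bar>) * \<bar>x v\<bar> + Q v / 2)"
    using good by (rule sum_mono)
  also have "\<dots> = (5 * ?r ^ 3 * \<delta> + ?r * \<delta> / m * \<bar>Y\<bar>) * (\<Sum>v\<in>U - ?B. \<bar>x v\<bar>) + (\<Sum>v\<in>U - ?B. Q v) / 2"
    by (simp add: sum.distrib sum_distrib_left sum_divide_distrib)
  also have "\<dots> \<le> (5 * ?r ^ 3 * \<delta> + ?r * \<delta> / m * \<bar>Y\<bar>) * X + 10 * ?r\<^sup>2 * \<delta> * ?\<Phi>"
  proof (rule add_mono)
    show "(5 * ?r ^ 3 * \<delta> + ?r * \<delta> / m * \<bar>Y\<bar>) * (\<Sum>v\<in>U - ?B. \<bar>x v\<bar>)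
        \<le> (5 * ?r ^ 3 * \<delta> + ?r * \<delta> / m * \<bar>Y\<bar>) * X"
      unfolding X_def using \<delta> m0 by (intro mult_left_mono sum_mono2) auto
    show "(\<Sum>v\<in>U - ?B. Q v) / 2 \<le> 10 * ?r\<^sup>2 * \<delta> * ?\<Phi>"
      using sum_good_neighbour_weights_le[OF \<delta>(1)] unfolding Q_def x_def y_def by simp
  qed
  also have "(\<Sum>v\<in>?B. d v) \<le> (\<Sum>v\<in>?B. A * (?r\<^sup>2 / m) * (x v)\<^sup>2)"
    using bad by (rule sum_mono)
  also have "\<dots> \<le> (\<Sum>v\<in>U. A * (?r\<^sup>2 / m) * (x v)\<^sup>2)"
    using A0 m0 bad_subset by (intro sum_mono2) auto
  also have "\<dots> = A * (?r\<^sup>2 * ?\<Phi> / m)"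
    unfolding dev_def x_def sum_distrib_left[symmetric] by simp
  finally have total: "(\<Sum>v\<in>U. d v) \<le> (5 * ?r ^ 3 * \<delta> + ?r * \<delta> / m * \<bar>Y\<bar>) * X
      + 10 * ?r\<^sup>2 * \<delta> * ?\<Phi> + A * (?r\<^sup>2 * ?\<Phi> / m)"
    by simp
  have X1: "X \<le> (m + ?\<Phi>) / 2"
  proof -
    have "X \<le> (\<Sum>v\<in>U. (1 + (x v)\<^sup>2) / 2)"
      unfolding X_def
    proof (rule sum_mono)
      fix v show "\<bar>x v\<bar> \<le> (1 + (x v)\<^sup>2) / 2"
        using zero_le_power2[of "\<bar>x v\<bar> - 1"] unfolding power2_diff by simp
    qed
    also have "\<dots> = (m + ?\<Phi>) / 2"
      by (simp add: sum.distrib sum_divide_distrib[symmetric] m_def dev_def x_def)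
    finally show ?thesis .
  qed
  have X2: "X\<^sup>2 \<le> m * ?\<Phi>"
    using Cauchy_Schwarz_ineq_sum[of "\<lambda>_. 1" "\<lambda>v. \<bar>x v\<bar>" U]
    by (simp add: X_def m_def dev_def x_def)
  have Y2: "Y\<^sup>2 \<le> m * (9 * ?r * ?\<Phi>)"
    using good_edges_deviation[OF \<delta>(1)] by (simp add: Y_def A_def m_def)
  \<comment> \<open>Both squares are \<open>O(m * \<Phi>)\<close>, so the division by
    \<open>m\<close> in the coefficient of \<open>Y\<close> leaves an error proportional to
    \<open>\<delta> * \<Phi>\<close> with no additive part.\<close>
  have XY: "\<bar>Y\<bar> * X \<le> 5 * ?r * m * ?\<Phi>"
  proof -
    have "2 * (\<bar>Y\<bar> * X) \<le> Y\<^sup>2 + X\<^sup>2"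
      using zero_le_power2[of "\<bar>Y\<bar> - X"] unfolding power2_diff by simp
    also have "\<dots> \<le> m * (9 * ?r * ?\<Phi>) + m * ?\<Phi>" using X2 Y2 by linarith
    also have "\<dots> = (9 * ?r + 1) * (m * ?\<Phi>)" by (simp add: algebra_simps)
    also have "\<dots> \<le> (10 * ?r) * (m * ?\<Phi>)"
      using r2 m0 dev_nonneg by (intro mult_right_mono) auto
    finally show ?thesis by (simp add: mult_ac)
  qed
  have "(5 * ?r ^ 3 * \<delta> + ?r * \<delta> / m * \<bar>Y\<bar>) * X = 5 * ?r ^ 3 * \<delta> * X + ?r * \<delta> / m * (\<bar>Y\<bar> * X)"
    by (simp add: algebra_simps)
  also have "\<dots> \<le> 5 * ?r ^ 3 * \<delta> * ((m + ?\<Phi>) / 2) + ?r * \<delta> / m * (5 * ?r * m * ?\<Phi>)"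
    using X1 XY \<delta> m0 by (intro add_mono mult_left_mono) auto
  also have "?r * \<delta> / m * (5 * ?r * m * ?\<Phi>) = 5 * ?r\<^sup>2 * \<delta> * ?\<Phi>"
    using m0 by (simp add: power2_eq_square)
  finally show ?thesis using total unfolding d_def x_def by simp
qed

lemma hdeg_remove:
  "hdeg {f \<in> F. f \<subseteq> U - e} v = hdeg F v - hits e v"
proof -
  have eq: "{f \<in> {f \<in> F. f \<subseteq> U - e}. v \<in> f} = {f \<in> F. v \<in> f} - {f \<in> F. v \<in> f \<and> f \<inter> e \<noteq> {}}"
    using edge_subset by blast
  have "card {f \<in> F. v \<in> f \<and> f \<inter> e \<noteq> {}} \<le> card {f \<in> F. v \<in> f}"
    by (intro card_mono) auto
  moreover have "card ({f \<in> F. v \<in> f} - {f \<in> F. v \<in> f \<and> f \<inter> e \<noteq> {}})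
      = card {f \<in> F. v \<in> f} - card {f \<in> F. v \<in> f \<and> f \<inter> e \<noteq> {}}"
    by (rule card_Diff_subset) auto
  ultimately show ?thesis unfolding hdeg_def hits_def eq by (simp add: of_nat_diff)
qed

text \<open>Up to the factor \<open>A\<close>, this is the average potential after deleting a
  uniformly chosen good edge. The hypothesis on \<open>A\<close> yields
  \<open>\<delta> \<le> 2 * r * A / m\<close>, which turns the drift, a total over all edges, into
  \<open>A\<close> times \<open>O(1 + \<Phi> / m)\<close>. The constants are 72 = 2 + 10 + 60 from
  the three drift terms, and 3 = 1 + 2 from \<open>m * g\<^sup>2\<close> and the squared
  hits.\<close>

theorem potential_step:
  fixes \<delta> g :: real
  defines "m \<equiv> real (card U)" and "A \<equiv> real (card (good_edges \<delta>))"
  assumes \<delta>: "\<delta> > 0" "\<delta> \<le> m"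
    and g: "0 \<le> g" "g \<le> (real r)\<^sup>2 * \<delta> / m"
    and g': "\<bar>m * g / real r - (real r - 1) * \<delta>\<bar> \<le> real r ^ 3 * \<delta> / m"
    and A: "m * \<delta> / 2 \<le> real r * A"
  shows "(\<Sum>e\<in>good_edges \<delta>. \<Sum>v\<in>U - e. (hdeg {f \<in> F. f \<subseteq> U - e} v - (\<delta> - g))\<^sup>2)
    \<le> A * ((1 + 72 * real r ^ 4 / m) * dev \<delta> + 10 * real r ^ 4 + 3 * real r ^ 4 * \<delta>)"
proof -
  let ?G = "good_edges \<delta>" and ?r = "real r" and ?\<Phi> = "dev \<delta>"
  define x where "x v = hdeg F v - \<delta>" for v
  have m0: "m > 0" using \<delta> by linarith
  have r2: "?r \<ge> 2" using edge_size by simp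
  have A0: "A \<ge> 0" by (simp add: A_def)
  have one: "(\<Sum>v\<in>U - e. (hdeg {f \<in> F. f \<subseteq> U - e} v - (\<delta> - g))\<^sup>2)
      \<le> ?\<Phi> + 2 * (\<Sum>v\<in>{v \<in> U. v \<notin> e}. x v * (g - hits e v)) + m * g\<^sup>2 + 2 * ?r ^ 3 * \<delta>"
    if e: "e \<in> ?G" for e
  proof -
    have U: "{v \<in> U. v \<notin> e} = U - e" by auto
    have "(\<Sum>v\<in>U - e. (hdeg {f \<in> F. f \<subseteq> U - e} v - (\<delta> - g))\<^sup>2)
        \<le> (\<Sum>v\<in>U - e. (x v)\<^sup>2 + 2 * (x v * (g - hits e v)) + g\<^sup>2 + (hits e v)\<^sup>2)"
    proof (rule sum_mono)
      fix v
      have eq: "hdeg {f \<in> F. f \<subseteq> U - e} v - (\<delta> - g) = x v + (g - hits e v)"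
        by (simp add: hdeg_remove x_def)
      \<comment> \<open>The mixed term \<open>- 2 * g * hits e v\<close> of the square is
        dropped.\<close>
      have "g * hits e v \<ge> 0" using g by simp
      then show "(hdeg {f \<in> F. f \<subseteq> U - e} v - (\<delta> - g))\<^sup>2
          \<le> (x v)\<^sup>2 + 2 * (x v * (g - hits e v)) + g\<^sup>2 + (hits e v)\<^sup>2"
        unfolding eq power2_eq_square by (simp add: algebra_simps)
    qed
    also have "\<dots> = (\<Sum>v\<in>U - e. (x v)\<^sup>2) + 2 * (\<Sum>v\<in>U - e. x v * (g - hits e v))
        + (\<Sum>v\<in>U - e. g\<^sup>2) + (\<Sum>v\<in>U - e. (hits e v)\<^sup>2)"
      by (simp only: sum.distrib sum_distrib_left)
    also have "(\<Sum>v\<in>U - e. (x v)\<^sup>2) \<le> ?\<Phi>"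
      unfolding dev_def x_def by (intro sum_mono2) auto
    also have "(\<Sum>v\<in>U - e. g\<^sup>2) \<le> (\<Sum>v\<in>U. g\<^sup>2)"
      by (intro sum_mono2) auto
    also have "\<dots> = m * g\<^sup>2" by (simp add: m_def)
    also have "(\<Sum>v\<in>U - e. (hits e v)\<^sup>2) \<le> 2 * ?r ^ 3 * \<delta>"
      using sum_hits_square_le[OF e] \<delta> by simp
    finally show ?thesis unfolding U by simp
  qed
  have "(\<Sum>e\<in>?G. \<Sum>v\<in>U - e. (hdeg {f \<in> F. f \<subseteq> U - e} v - (\<delta> - g))\<^sup>2)
      \<le> (\<Sum>e\<in>?G. ?\<Phi> + 2 * (\<Sum>v\<in>{v \<in> U. v \<notin> e}. x v * (g - hits e v)) + m * g\<^sup>2 + 2 * ?r ^ 3 * \<delta>)"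
    using one by (rule sum_mono)
  also have "\<dots> = A * (?\<Phi> + m * g\<^sup>2 + 2 * ?r ^ 3 * \<delta>)
      + 2 * (\<Sum>e\<in>?G. \<Sum>v\<in>{v \<in> U. v \<notin> e}. x v * (g - hits e v))"
    by (simp add: sum.distrib sum_distrib_left[symmetric] A_def algebra_simps)
  also have "(\<Sum>e\<in>?G. \<Sum>v\<in>{v \<in> U. v \<notin> e}. x v * (g - hits e v))
      = (\<Sum>v\<in>U. \<Sum>e\<in>{e \<in> ?G. v \<notin> e}. x v * (g - hits e v))"
    by (rule sum.swap_restrict) auto
  also have "\<dots> = (\<Sum>v\<in>U. x v * (\<Sum>e\<in>{e \<in> ?G. v \<notin> e}. g - hits e v))"
    by (simp only: sum_distrib_left)
  also have "\<dots> \<le> A * (?r\<^sup>2 * ?\<Phi> / m) + 5 / 2 * ?r ^ 3 * \<delta> * (m + ?\<Phi>) + 15 * ?r\<^sup>2 * \<delta> * ?\<Phi>"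
    unfolding x_def A_def m_def
    by (rule drift_bound) (use \<delta> g g' in \<open>simp_all add: m_def\<close>)
  finally have le: "(\<Sum>e\<in>?G. \<Sum>v\<in>U - e. (hdeg {f \<in> F. f \<subseteq> U - e} v - (\<delta> - g))\<^sup>2)
      \<le> A * (?\<Phi> + m * g\<^sup>2 + 2 * ?r ^ 3 * \<delta>)
        + 2 * (A * (?r\<^sup>2 * ?\<Phi> / m) + 5 / 2 * ?r ^ 3 * \<delta> * (m + ?\<Phi>) + 15 * ?r\<^sup>2 * \<delta> * ?\<Phi>)"
    by simp
  have \<delta>A: "\<delta> \<le> 2 * ?r * A / m" using A m0 by (simp add: field_simps)
  define p where "p = ?\<Phi> / m"
  have p0: "p \<ge> 0" using dev_nonneg m0 by (simp add: p_def)
  have \<Phi>: "?\<Phi> = p * m" using m0 by (simp add: p_def)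
  have 1: "5 / 2 * ?r ^ 3 * \<delta> * (m + ?\<Phi>) \<le> A * (5 * ?r ^ 4 * (1 + p))"
  proof -
    have "5 / 2 * ?r ^ 3 * (m + ?\<Phi>) * \<delta> \<le> 5 / 2 * ?r ^ 3 * (m + ?\<Phi>) * (2 * ?r * A / m)"
      using m0 dev_nonneg[of \<delta>] \<delta>A by (intro mult_left_mono) auto
    also have "\<dots> = A * (5 * ?r ^ 4 * (1 + p))"
      using m0 by (simp add: \<Phi> field_simps power3_eq_cube power4_eq_xxxx)
    finally show ?thesis by (simp add: mult_ac)
  qed
  have 2: "15 * ?r\<^sup>2 * \<delta> * ?\<Phi> \<le> A * (30 * ?r ^ 3 * p)"
  proof -
    have "15 * ?r\<^sup>2 * ?\<Phi> * \<delta> \<le> 15 * ?r\<^sup>2 * ?\<Phi> * (2 * ?r * A / m)"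
      using m0 dev_nonneg[of \<delta>] \<delta>A by (intro mult_left_mono) auto
    also have "\<dots> = A * (30 * ?r ^ 3 * p)"
      using m0 by (simp add: \<Phi> power2_eq_square power3_eq_cube)
    finally show ?thesis by (simp add: mult_ac)
  qed
  have 3: "m * g\<^sup>2 \<le> ?r ^ 4 * \<delta>"
  proof -
    have "g\<^sup>2 \<le> (?r\<^sup>2 * \<delta> / m)\<^sup>2" using g by (intro power_mono) auto
    then have "m * g\<^sup>2 \<le> m * (?r\<^sup>2 * \<delta> / m)\<^sup>2" using m0 by (intro mult_left_mono) auto
    also have "\<dots> = ?r ^ 4 * \<delta> * (\<delta> / m)" using m0 by (simp add: power2_eq_square power4_eq_xxxx)
    also have "\<dots> \<le> ?r ^ 4 * \<delta> * 1" using \<delta> m0 by (intro mult_left_mono) auto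
    finally show ?thesis by simp
  qed
  have r24: "?r\<^sup>2 \<le> ?r ^ 4" and r34: "?r ^ 3 \<le> ?r ^ 4" using r2 by (auto intro: power_increasing)
  have "2 * ?r\<^sup>2 * p + 10 * ?r ^ 4 * p + 60 * ?r ^ 3 * p \<le> 72 * ?r ^ 4 * p"
    using mult_right_mono[OF r24 p0] mult_right_mono[OF r34 p0] by linarith
  moreover have "2 * ?r ^ 3 * \<delta> \<le> 2 * ?r ^ 4 * \<delta>" using r34 \<delta> by simp
  ultimately have "(?\<Phi> + m * g\<^sup>2 + 2 * ?r ^ 3 * \<delta>) + 2 * (?r\<^sup>2 * p + 5 * ?r ^ 4 * (1 + p) + 30 * ?r ^ 3 * p)
      \<le> ?\<Phi> + 72 * ?r ^ 4 * p + 10 * ?r ^ 4 + 3 * ?r ^ 4 * \<delta>"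
    using 3 by (simp add: algebra_simps)
  also have "\<dots> = (1 + 72 * ?r ^ 4 / m) * ?\<Phi> + 10 * ?r ^ 4 + 3 * ?r ^ 4 * \<delta>"
    by (simp add: p_def algebra_simps)
  finally have "A * ((?\<Phi> + m * g\<^sup>2 + 2 * ?r ^ 3 * \<delta>) + 2 * (?r\<^sup>2 * p + 5 * ?r ^ 4 * (1 + p) + 30 * ?r ^ 3 * p))
      \<le> A * ((1 + 72 * ?r ^ 4 / m) * ?\<Phi> + 10 * ?r ^ 4 + 3 * ?r ^ 4 * \<delta>)"
    using A0 by (rule mult_left_mono)
  moreover have "A * (?\<Phi> + m * g\<^sup>2 + 2 * ?r ^ 3 * \<delta>)
        + 2 * (A * (?r\<^sup>2 * ?\<Phi> / m) + 5 / 2 * ?r ^ 3 * \<delta> * (m + ?\<Phi>) + 15 * ?r\<^sup>2 * \<delta> * ?\<Phi>)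
      \<le> A * (?\<Phi> + m * g\<^sup>2 + 2 * ?r ^ 3 * \<delta>)
        + 2 * (A * (?r\<^sup>2 * p) + A * (5 * ?r ^ 4 * (1 + p)) + A * (30 * ?r ^ 3 * p))"
    by (intro add_mono mult_left_mono 1 2) (use A0 m0 in \<open>auto simp: p_def\<close>)
  moreover have "\<dots> = A * ((?\<Phi> + m * g\<^sup>2 + 2 * ?r ^ 3 * \<delta>) + 2 * (?r\<^sup>2 * p + 5 * ?r ^ 4 * (1 + p) + 30 * ?r ^ 3 * p))"
    by (simp only: distrib_left mult.left_commute[of 2 A])
  ultimately show ?thesis using le by linarith
qed

section \<open>Counting matchings by deleting one edge\<close>

lemma finite_matchings [simp]: "finite (matchings F W)"
  by (rule finite_subset[of _ "Pow F"]) (auto simp: matchings_def)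

lemma card_matchings_pos: "card (matchings F W) > 0"
proof -
  have "{} \<in> matchings F W" by (auto simp: matchings_def)
  then show ?thesis using card_gt_0_iff finite_matchings by blast
qed

lemma card_matching:
  assumes "M \<in> matchings F W" "finite W"
  shows "r * card M \<le> card W"
proof -
  have M: "M \<subseteq> F" "\<Union>M \<subseteq> W" "pairwise disjnt M" using assms by (auto simp: matchings_def)
  have "card (\<Union>M) = (\<Sum>e\<in>M. card e)"
    using M finite_edge by (intro card_Union_disjoint) auto
  also have "\<dots> = r * card M" using M edge_card by (simp add: subset_iff)
  finally show ?thesis using card_mono[OF assms(2) M(2)] by simp
qed

text \<open>Adding \<open>e\<close> injects the matchings inside \<open>W - e\<close> into those
  inside \<open>W\<close> that contain \<open>e\<close>, and a matching inside \<open>W\<close> has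
  at most \<open>card W / r\<close> edges. Any \<open>G\<close> is allowed, so the sum can be
  restricted to good edges.\<close>

lemma card_matchings_recurrence:
  assumes "G \<subseteq> F" "\<And>e. e \<in> G \<Longrightarrow> e \<subseteq> W" "finite W"
  shows "r * (\<Sum>e\<in>G. card (matchings F (W - e))) \<le> card W * card (matchings F W)"
proof -
  have finG: "finite G" using assms finite_F finite_subset by blast
  have "(\<Sum>e\<in>G. card (matchings F (W - e))) \<le> (\<Sum>e\<in>G. card {M \<in> matchings F W. e \<in> M})"
  proof (rule sum_mono)
    fix e assume e: "e \<in> G"
    have eF: "e \<in> F" using assms e by blast
    have e0: "e \<noteq> {}" using edge_card[OF eF] edge_size by auto
    have notin: "e \<notin> M" if "M \<in> matchings F (W - e)" for M
      using that e0 by (auto simp: matchings_def)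
    have "inj_on (insert e) (matchings F (W - e))"
      using notin by (intro inj_onI) (metis insert_ident)
    moreover have "insert e ` matchings F (W - e) \<subseteq> {M \<in> matchings F W. e \<in> M}"
    proof
      fix M' assume "M' \<in> insert e ` matchings F (W - e)"
      then obtain M where M: "M' = insert e M" "M \<subseteq> F" "\<Union>M \<subseteq> W - e" "pairwise disjnt M"
        by (auto simp: matchings_def)
      have "disjnt e f" if "f \<in> M" for f using that M by (auto simp: disjnt_def)
      then have "pairwise disjnt M'" using M by (auto simp: pairwise_insert disjnt_sym)
      then show "M' \<in> {M \<in> matchings F W. e \<in> M}"
        using M eF assms(2)[OF e] by (auto simp: matchings_def)
    qed
    ultimately show "card (matchings F (W - e)) \<le> card {M \<in> matchings F W. e \<in> M}"
      by (intro card_inj_on_le[where f = "insert e"]) auto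
  qed
  also have "\<dots> = (\<Sum>e\<in>G. \<Sum>M\<in>{M \<in> matchings F W. e \<in> M}. 1)" by simp
  also have "\<dots> = (\<Sum>M\<in>matchings F W. \<Sum>e\<in>{e \<in> G. e \<in> M}. 1)"
    using finG by (intro sum.swap_restrict) auto
  also have "\<dots> \<le> (\<Sum>M\<in>matchings F W. card M)"
  proof (rule sum_mono)
    fix M assume "M \<in> matchings F W"
    then have "finite M" by (auto simp: matchings_def intro: finite_subset[OF _ finite_F])
    then show "(\<Sum>e\<in>{e \<in> G. e \<in> M}. 1) \<le> card M" by (simp, intro card_mono) auto
  qed
  finally have "r * (\<Sum>e\<in>G. card (matchings F (W - e))) \<le> (\<Sum>M\<in>matchings F W. r * card M)"
    by (simp add: sum_distrib_left[symmetric])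
  also have "\<dots> \<le> (\<Sum>M\<in>matchings F W. card W)"
    using card_matching assms(3) by (intro sum_mono) auto
  finally show ?thesis by (simp add: mult.commute)
qed

end

section \<open>Matchings in regular linear hypergraphs\<close>

text \<open>The bound \<open>degree_le\<close> keeps the target degree at or below the current
  number of vertices, as \<open>potential_step\<close> requires.\<close>

locale regular_linear_hypergraph = linear_hypergraph V E r for V :: "'a set" and E r +
  fixes D :: nat
  assumes regular: "\<And>v. v \<in> V \<Longrightarrow> hdeg E v = real D"
    and degree_pos: "D \<ge> 1"
    and degree_le: "D \<le> card V"
begin

abbreviation induced :: "'a set \<Rightarrow> 'a set set" where
  "induced W \<equiv> {f \<in> E. f \<subseteq> W}"

text \<open>The expected degree of a surviving vertex if every other vertex survives independently
  with probability \<open>t / card V\<close>.\<close>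

definition target :: "real \<Rightarrow> real" where
  "target t = real D * (t / real (card V)) ^ (r - 1)"

definition potential :: "'a set \<Rightarrow> real" where
  "potential W = (\<Sum>v\<in>W. (hdeg (induced W) v - target (real (card W)))\<^sup>2)"

lemma linear_hypergraph_induced:
  assumes "W \<subseteq> V"
  shows "linear_hypergraph W (induced W) r"
proof
  show "finite W" using assms finite_U finite_subset by blast
  show "r \<ge> 2" by (rule edge_size)
  show "card e = r" if "e \<in> induced W" for e using that edge_card by auto
  show "e = f" if "e \<in> induced W" "f \<in> induced W" "x \<in> e \<inter> f" "y \<in> e \<inter> f" "x \<noteq> y" for e f x y
    using linear[of e f x y] that by blast
qed auto

lemma potential_nonneg: "potential W \<ge> 0"
  by (auto simp: potential_def intro: sum_nonneg)

lemma card_V_pos: "real (card V) > 0"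
  using degree_pos degree_le by linarith

lemma potential_V: "potential V = 0"
proof -
  have "induced V = E" using edge_subset by auto
  then show ?thesis using card_V_pos by (simp add: potential_def target_def regular)
qed

text \<open>One greedy step, with \<open>G\<close> the good edges. Since \<open>dmin\<close> can be
  chosen for the whole process, the coefficient of the potential does not depend on
  \<open>W\<close>. The smallness hypothesis guarantees at least half of the expected number of good
  edges.\<close>

lemma ln_card_matchings_step:
  fixes \<eta> dmin :: real
  assumes W: "W \<subseteq> V" and m: "real (card W) > real r"
    and dmin: "0 < dmin" "dmin \<le> target (real (card W))" and \<eta>: "\<eta> > 0"
    and small: "9 * real r * potential W \<le> real (card W) * dmin\<^sup>2 / 4"
  obtains G where "G \<subseteq> induced W" "G \<noteq> {}"
    and "ln (real (card (matchings E W))) \<ge> ln (target (real (card W))) - \<eta>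
          - 9 * real r / (dmin\<^sup>2 * \<eta>) * potential W / real (card W)
          + (\<Sum>e\<in>G. ln (real (card (matchings E (W - e))))) / real (card G)"
    and "(\<Sum>e\<in>G. potential (W - e)) / real (card G)
          \<le> (1 + 72 * real r ^ 4 / real (card W)) * potential W + 13 * real r ^ 4 * real D"
proof -
  interpret W: linear_hypergraph W "induced W" r using W by (rule linear_hypergraph_induced)
  let ?r = "real r"
  define m where "m = real (card W)"
  define \<delta> where "\<delta> = target m"
  define G where "G = W.good_edges \<delta>"
  define A where "A = real (card G)"
  define Y where "Y = ?r * A - m * \<delta>"
  define \<Phi> where "\<Phi> = potential W"
  define N where "N = real (card V)"
  have finW: "finite W" by simp
  have mr: "m > ?r" and r2: "?r \<ge> 2" and N0: "N > 0"
    using m edge_size card_V_pos by (auto simp: m_def N_def)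
  have m0: "m > 0" using mr by linarith
  have mN: "m \<le> N" unfolding m_def N_def using W finite_U by (simp add: card_mono)
  have \<delta>: "\<delta> > 0" and dmin': "dmin \<le> \<delta>" using dmin by (auto simp: \<delta>_def m_def)
  have \<delta>D: "\<delta> \<le> real D"
  proof -
    have "(m / N) ^ (r - 1) \<le> 1" using m0 N0 mN by (intro power_le_one) auto
    then show ?thesis unfolding \<delta>_def target_def N_def[symmetric]
      using mult_left_mono[of "(m / N) ^ (r - 1)" 1 "real D"] by simp
  qed
  have \<delta>m: "\<delta> \<le> m"
  proof -
    have "(m / N) ^ (r - 1) \<le> (m / N) ^ 1"
      using m0 N0 mN edge_size by (intro power_decreasing) auto
    then have "\<delta> \<le> real D * (m / N)" unfolding \<delta>_def target_def N_def[symmetric]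
      by (intro mult_left_mono) auto
    also have "\<dots> \<le> N * (m / N)" using degree_le m0 N0 by (intro mult_right_mono) (auto simp: N_def)
    finally show ?thesis using N0 by simp
  qed
  have \<Phi>: "\<Phi> = W.dev \<delta>" by (simp add: \<Phi>_def potential_def W.dev_def \<delta>_def m_def)
  have "Y\<^sup>2 \<le> m * (9 * ?r * \<Phi>)"
    using W.good_edges_deviation[OF \<delta>] by (simp add: Y_def A_def G_def m_def \<Phi>)
  also have Y2: "\<dots> \<le> m * (m * \<delta>\<^sup>2 / 4)"
  proof -
    have "dmin\<^sup>2 \<le> \<delta>\<^sup>2" using dmin dmin' by (intro power_mono) auto
    then have "m * dmin\<^sup>2 / 4 \<le> m * \<delta>\<^sup>2 / 4" using m0 by simp
    then have "9 * ?r * \<Phi> \<le> m * \<delta>\<^sup>2 / 4" using small by (simp add: \<Phi>_def m_def)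
    then show ?thesis using m0 by (intro mult_left_mono) auto
  qed
  also have "\<dots> = (m * \<delta> / 2)\<^sup>2" by (simp add: power2_eq_square)
  finally have Yle: "\<bar>Y\<bar> \<le> m * \<delta> / 2"
    using m0 \<delta> by (intro power2_le_imp_le[of "\<bar>Y\<bar>"]) auto
  have A: "m * \<delta> / 2 \<le> ?r * A" using abs_le_D2[OF Yle] unfolding Y_def by (simp add: mult.commute)
  have "m * \<delta> / 2 > 0" using m0 \<delta> by simp
  then have "?r * A > 0" using A by (rule less_le_trans)
  then have A0: "A > 0" using r2 by (simp add: zero_less_mult_iff)
  then have G0: "G \<noteq> {}" by (auto simp: A_def)
  have GW: "G \<subseteq> induced W" unfolding G_def by (rule W.good_edges_subset)
  have finG: "finite G" unfolding G_def by simp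
  \<comment> \<open>The recurrence bounds the count below by \<open>r * A / m\<close>, the average
    good degree, times the average count over \<open>W - e\<close>; Jensen then moves the logarithm
    inside the average.\<close>
  have "ln (real (card (matchings E W))) \<ge> ln (?r * A / m) + (\<Sum>e\<in>G. ln (real (card (matchings E (W - e))))) / A"
  proof -
    define z where "z e = real (card (matchings E (W - e)))" for e
    have z0: "z e > 0" for e using card_matchings_pos by (simp add: z_def)
    have "r * (\<Sum>e\<in>G. card (matchings E (W - e))) \<le> card W * card (matchings E W)"
      using GW finW by (intro card_matchings_recurrence) auto
    then have "real (r * (\<Sum>e\<in>G. card (matchings E (W - e)))) \<le> real (card W * card (matchings E W))"
      by (rule of_nat_mono)
    then have "?r * (\<Sum>e\<in>G. z e) \<le> m * real (card (matchings E W))"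
      by (simp add: z_def m_def)
    then have le: "(?r * A / m) * ((\<Sum>e\<in>G. z e) / A) \<le> real (card (matchings E W))"
      using m0 A0 by (simp add: field_simps)
    have sum0: "(\<Sum>e\<in>G. z e) > 0" using z0 finG G0 by (intro sum_pos) auto
    have pos: "?r * A / m > 0" "(\<Sum>e\<in>G. z e) / A > 0" using r2 A0 m0 sum0 by auto
    have "(\<Sum>e\<in>G. ln (z e)) / A \<le> ln ((\<Sum>e\<in>G. z e) / A)"
      using sum_ln_le_ln_average[OF finG G0, of z] z0 A0 by (simp add: A_def field_simps)
    then have "ln (?r * A / m) + (\<Sum>e\<in>G. ln (z e)) / A \<le> ln ((?r * A / m) * ((\<Sum>e\<in>G. z e) / A))"
      using pos by (subst ln_mult_pos) auto
    also have "\<dots> \<le> ln (real (card (matchings E W)))"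
      using le pos mult_pos_pos[OF pos] by (subst ln_le_cancel_iff) (auto intro: less_le_trans)
    finally show ?thesis by (simp add: z_def)
  qed
  moreover have "ln (?r * A / m) \<ge> ln \<delta> - \<eta> - 9 * ?r / (dmin\<^sup>2 * \<eta>) * \<Phi> / m"
  proof -
    have eq: "?r * A / m = \<delta> + Y / m" using m0 by (simp add: Y_def field_simps)
    have "\<bar>Y / m\<bar> \<le> \<delta> / 2" using Yle m0 by (simp add: field_simps)
    then have "ln (?r * A / m) \<ge> ln \<delta> - \<eta> - (Y / m)\<^sup>2 / (\<delta>\<^sup>2 * \<eta>)"
      unfolding eq using \<delta> \<eta> by (intro ln_ge_of_relative_deviation) auto
    moreover have "(Y / m)\<^sup>2 / (\<delta>\<^sup>2 * \<eta>) \<le> 9 * ?r / (dmin\<^sup>2 * \<eta>) * \<Phi> / m"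
    proof -
      have "(Y / m)\<^sup>2 / (\<delta>\<^sup>2 * \<eta>) \<le> (9 * ?r * \<Phi> / m) / (dmin\<^sup>2 * \<eta>)"
      proof (rule frac_le)
        show "(Y / m)\<^sup>2 \<le> 9 * ?r * \<Phi> / m"
          using \<open>Y\<^sup>2 \<le> m * (9 * ?r * \<Phi>)\<close> m0 by (simp add: power_divide field_simps power2_eq_square)
        show "dmin\<^sup>2 * \<eta> \<le> \<delta>\<^sup>2 * \<eta>"
          using dmin dmin' \<eta> by (intro mult_right_mono power_mono) auto
        show "0 < dmin\<^sup>2 * \<eta>" using dmin \<eta> by simp
        show "0 \<le> 9 * ?r * \<Phi> / m" using potential_nonneg m0 by (simp add: \<Phi>_def)
      qed
      then show ?thesis by (simp add: mult_ac)
    qed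
    ultimately show ?thesis by linarith
  qed
  moreover have "(\<Sum>e\<in>G. potential (W - e)) / A \<le> (1 + 72 * ?r ^ 4 / m) * \<Phi> + 13 * ?r ^ 4 * real D"
  proof -
    define g where "g = \<delta> - \<delta> * (1 - ?r / m) ^ (r - 1)"
    \<comment> \<open>The target is a power function, so passing to \<open>m - r\<close> vertices
      multiplies it by \<open>(1 - r / m) ^ (r - 1)\<close>.\<close>
    have tgt: "target (m - ?r) = \<delta> - g"
    proof -
      have "(m - ?r) / N = m / N * (1 - ?r / m)" using m0 N0 by (simp add: field_simps)
      then have "target (m - ?r) = real D * (m / N * (1 - ?r / m)) ^ (r - 1)"
        by (simp only: target_def N_def)
      also have "\<dots> = \<delta> * (1 - ?r / m) ^ (r - 1)"
        by (simp only: power_mult_distrib \<delta>_def target_def N_def mult.assoc)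
      finally show ?thesis by (simp add: g_def)
    qed
    have pot: "potential (W - e) = (\<Sum>v\<in>W - e. (hdeg {f \<in> induced W. f \<subseteq> W - e} v - (\<delta> - g))\<^sup>2)"
      if e: "e \<in> G" for e
    proof -
      have eW: "e \<in> E" "e \<subseteq> W" using e GW by auto
      have "card (W - e) = card W - r"
        using eW edge_card finite_edge by (simp add: card_Diff_subset)
      moreover have "r \<le> card W" using mr by (simp add: m_def)
      ultimately have "real (card (W - e)) = m - ?r" by (simp add: m_def of_nat_diff)
      moreover have "induced (W - e) = {f \<in> induced W. f \<subseteq> W - e}" by auto
      ultimately show ?thesis by (simp only: potential_def tgt)
    qed
    have "(\<Sum>e\<in>G. potential (W - e)) \<le> A * ((1 + 72 * ?r ^ 4 / m) * \<Phi> + 10 * ?r ^ 4 + 3 * ?r ^ 4 * \<delta>)"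
      by (subst sum.cong[OF refl pot], assumption, rule W.potential_step[of \<delta> g, folded m_def G_def, folded A_def \<Phi>, OF \<delta> \<delta>m
            target_degree_step[OF edge_size \<delta> mr, folded g_def] A])
    also have "\<dots> \<le> A * ((1 + 72 * ?r ^ 4 / m) * \<Phi> + 13 * ?r ^ 4 * real D)"
    proof (intro mult_left_mono)
      have "10 * ?r ^ 4 * 1 \<le> 10 * ?r ^ 4 * real D" using degree_pos by (intro mult_left_mono) auto
      moreover have "3 * ?r ^ 4 * \<delta> \<le> 3 * ?r ^ 4 * real D" using \<delta>D by (intro mult_left_mono) auto
      ultimately show "(1 + 72 * ?r ^ 4 / m) * \<Phi> + 10 * ?r ^ 4 + 3 * ?r ^ 4 * \<delta>
          \<le> (1 + 72 * ?r ^ 4 / m) * \<Phi> + 13 * ?r ^ 4 * real D" by linarith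
    qed (use A0 in auto)
    finally show ?thesis using A0 by (simp add: pos_divide_le_eq mult.commute)
  qed
  ultimately show thesis
    using that[OF GW G0] by (simp add: A_def \<delta>_def m_def \<Phi>_def)
qed

text \<open>
  Below \<open>\<kappa> N\<close> vertices only \<open>Z W \<ge> 1\<close> is used; the exponent \<open>K\<close> makes the coefficient of the potential
  absorb the growth factor \<open>1 + 72 r\<^sup>4 / |W|\<close> of each step.
\<close>

theorem ln_card_matchings_ge:
  fixes \<kappa> \<eta> :: real
  defines "N \<equiv> real (card V)" and "K \<equiv> 72 * r ^ 4 + 1"
  assumes \<kappa>: "0 < \<kappa>" and \<eta>: "0 < \<eta>" "4 * \<eta> * ln (real D) \<le> real r"
  shows "ln (real (card (matchings E V))) \<ge> N / real r * (ln (real D) - (real r - 1)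
    - (\<eta> + 117 * real r ^ 5 / (real D * \<eta> * \<kappa> ^ (K + 2 * (r - 1))) + \<kappa> * ln (real D) + real r * ln (real D) / N))"
proof -
  let ?r = "real r" and ?L = "ln (real D)"
  \<comment> \<open>The target degree at \<open>\<kappa> * N\<close> vertices, a lower bound for the
    target at every larger size.\<close>
  define dmin where "dmin = \<kappa> ^ (r - 1) * real D"
  define \<beta> where "\<beta> = 9 * ?r / (dmin\<^sup>2 * \<eta>)"
  \<comment> \<open>The weight is \<beta> at \<open>\<kappa> * N\<close> vertices and grows with
    \<open>t\<close>: induction runs from small sets to large ones, so the weight at
    \<open>m\<close> must pay for the growth of the potential on the way down to
    \<open>m - r\<close>.\<close>
  define b where "b t = \<beta> * (t / (\<kappa> * N)) ^ K" for t
  \<comment> \<open>The additive growth of the potential in one step, times the largest weight,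
    attained at \<open>t = N\<close>.\<close>
  define noise where "noise = \<beta> / \<kappa> ^ K * (13 * ?r ^ 4 * real D)"
  define S where "S t = (t * ?L + (?r - 1) * (t * ln (t / N) - t)) / ?r" for t
  \<comment> \<open>Each step removes \<open>r\<close> vertices and loses
    \<open>\<eta> + noise\<close>. The last term makes \<open>a\<close> nonpositive up to
    \<open>\<kappa> * N + r\<close> vertices; its summand \<open>r\<close> keeps the set after a
    step at no fewer than \<open>\<kappa> * N\<close> vertices.\<close>
  define a where "a t = S t - (\<eta> + noise) * t / ?r - (\<kappa> * N + ?r) * ?L / ?r" for t
  have r2: "?r \<ge> 2" using edge_size by simp
  have D1: "real D \<ge> 1" using degree_pos by simp
  have L0: "?L \<ge> 0" using D1 by simp
  have N0: "N > 0" using card_V_pos by (simp add: N_def)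
  have dmin0: "dmin > 0" using \<kappa> D1 by (simp add: dmin_def)
  have \<beta>0: "\<beta> > 0" using r2 dmin0 \<eta> by (simp add: \<beta>_def)
  have noise0: "noise \<ge> 0" using \<beta>0 \<kappa> by (simp add: noise_def)
  have S_le: "S t \<le> t * ?L / ?r" if "0 \<le> t" "t \<le> N" for t
  proof -
    have "t * ln (t / N) \<le> 0"
    proof (cases "t = 0")
      case False
      then have "ln (t / N) \<le> 0" using that N0 by simp
      then show ?thesis using that by (simp add: mult_nonneg_nonpos)
    qed simp
    then have "(?r - 1) * (t * ln (t / N) - t) \<le> 0" using r2 that by (intro mult_nonneg_nonpos) auto
    then show ?thesis unfolding S_def using r2 by (intro divide_right_mono) auto
  qed
  have b_nonneg: "b t \<ge> 0" if "t \<ge> 0" for t using that \<beta>0 \<kappa> N0 by (simp add: b_def)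
  have main: "a (real (card W)) - b (real (card W)) * potential W \<le> ln (real (card (matchings E W)))"
    if "W \<subseteq> V" for W
    using that
  proof (induction "card W" arbitrary: W rule: less_induct)
    case less
    define m where "m = real (card W)"
    define \<Phi> where "\<Phi> = potential W"
    have mN: "0 \<le> m" "m \<le> N" using less.prems finite_U by (auto simp: m_def N_def card_mono)
    have \<Phi>0: "\<Phi> \<ge> 0" by (simp add: \<Phi>_def potential_nonneg)
    have Z0: "0 \<le> ln (real (card (matchings E W)))" using card_matchings_pos[of W] by simp
    have a_le: "a m \<le> m * ?L / ?r - (\<kappa> * N + ?r) * ?L / ?r"
    proof -
      have "(\<eta> + noise) * m / ?r \<ge> 0" using \<eta> noise0 mN r2 by simp
      then show ?thesis using S_le[OF mN] by (simp add: a_def)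
    qed
    \<comment> \<open>In the first two cases the left side is nonpositive, and the empty matching
      makes the right side nonnegative. In the third, \<open>a m > b m * \<Phi>\<close> itself
      bounds the potential.\<close>
    consider "m < \<kappa> * N + ?r" | "a m \<le> b m * \<Phi>" | "m \<ge> \<kappa> * N + ?r" "a m > b m * \<Phi>" by linarith
    then show ?case
    proof cases
      case 1
      then have "m * ?L / ?r \<le> (\<kappa> * N + ?r) * ?L / ?r"
        using L0 r2 by (intro divide_right_mono mult_right_mono) auto
      moreover have "b m * \<Phi> \<ge> 0" using b_nonneg[OF mN(1)] \<Phi>0 by simp
      ultimately show ?thesis using a_le Z0 unfolding m_def \<Phi>_def by linarith
    next
      case 2
      then show ?thesis using Z0 unfolding m_def \<Phi>_def by linarith
    next
      case 3
      have \<kappa>N: "\<kappa> * N > 0" using \<kappa> N0 by simp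
      have mr: "m > ?r" and mr': "m - ?r \<ge> \<kappa> * N" and m\<kappa>: "m \<ge> \<kappa> * N" and m0: "m > 0"
        using 3 \<kappa>N r2 by linarith+
      have dmin_le: "dmin \<le> target m"
      proof -
        have "\<kappa> \<le> m / N" using m\<kappa> N0 by (simp add: field_simps)
        then have "\<kappa> ^ (r - 1) \<le> (m / N) ^ (r - 1)" using \<kappa> by (intro power_mono) auto
        then show ?thesis by (simp add: dmin_def target_def N_def[symmetric] mult.commute mult_left_mono)
      qed
      have b_ge: "b t \<ge> \<beta>" if "t \<ge> \<kappa> * N" for t
      proof -
        have "1 \<le> (t / (\<kappa> * N)) ^ K" using that \<kappa>N by (intro one_le_power) simp
        then show ?thesis unfolding b_def using \<beta>0 by (simp add: mult_le_cancel_left1)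
      qed
      have "\<beta> * \<Phi> \<le> m * ?L / ?r"
      proof -
        have "\<beta> * \<Phi> \<le> b m * \<Phi>" using b_ge[OF m\<kappa>] \<Phi>0 by (rule mult_right_mono)
        also have "\<dots> \<le> a m" using 3 by simp
        also have "\<dots> \<le> m * ?L / ?r"
        proof -
          have "(\<kappa> * N + ?r) * ?L / ?r \<ge> 0" using \<kappa>N r2 L0 by simp
          then show ?thesis using a_le by linarith
        qed
        finally show ?thesis .
      qed
      \<comment> \<open>Unfolding \<beta> and using \<open>4 * \<eta> * ln D \<le> r\<close> gives
        the smallness that the greedy step asks for.\<close>
      then have "9 * ?r * \<Phi> \<le> m * ?L / ?r * (dmin\<^sup>2 * \<eta>)"
        using dmin0 \<eta> by (simp add: \<beta>_def field_simps)
      also have "\<dots> = m * dmin\<^sup>2 * (4 * \<eta> * ?L) / (4 * ?r)" by simp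
      also have "\<dots> \<le> m * dmin\<^sup>2 * ?r / (4 * ?r)"
        using \<eta> m0 r2 by (intro divide_right_mono mult_left_mono) auto
      also have "\<dots> = m * dmin\<^sup>2 / 4" using r2 by simp
      finally have small: "9 * ?r * \<Phi> \<le> m * dmin\<^sup>2 / 4" .
      obtain G where G: "G \<subseteq> induced W" "G \<noteq> {}"
        and lnZ: "ln (real (card (matchings E W))) \<ge> ln (target m) - \<eta> - \<beta> * \<Phi> / m
          + (\<Sum>e\<in>G. ln (real (card (matchings E (W - e))))) / real (card G)"
        and pot: "(\<Sum>e\<in>G. potential (W - e)) / real (card G)
          \<le> (1 + 72 * ?r ^ 4 / m) * \<Phi> + 13 * ?r ^ 4 * real D"
        by (rule ln_card_matchings_step[OF less.prems, of dmin \<eta>, folded m_def \<Phi>_def \<beta>_def,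
              OF mr dmin0 dmin_le \<eta>(1) small])
      have finG: "finite G" by (rule finite_subset[OF G(1)]) simp
      define A where "A = real (card G)"
      have A0: "A > 0" using G finG by (simp add: A_def card_gt_0_iff)
      have "A * a (m - ?r) - b (m - ?r) * (\<Sum>e\<in>G. potential (W - e))
          = (\<Sum>e\<in>G. a (m - ?r) - b (m - ?r) * potential (W - e))"
        by (simp add: sum_subtractf sum_distrib_left A_def)
      also have "\<dots> \<le> (\<Sum>e\<in>G. ln (real (card (matchings E (W - e)))))"
      proof (rule sum_mono)
        fix e assume e: "e \<in> G"
        have eW: "e \<in> E" "e \<subseteq> W" using e G by auto
        have "card (W - e) = card W - r"
          using eW edge_card finite_edge by (simp add: card_Diff_subset)
        moreover have "r < card W" using mr by (simp add: m_def)
        ultimately have card: "real (card (W - e)) = m - ?r" and lt: "card (W - e) < card W"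
          using edge_size by (auto simp: m_def of_nat_diff)
        show "a (m - ?r) - b (m - ?r) * potential (W - e) \<le> ln (real (card (matchings E (W - e))))"
          using less.hyps[OF lt] less.prems unfolding card by blast
      qed
      finally have "(A * a (m - ?r) - b (m - ?r) * (\<Sum>e\<in>G. potential (W - e))) / A
          \<le> (\<Sum>e\<in>G. ln (real (card (matchings E (W - e))))) / A"
        using A0 by (intro divide_right_mono) auto
      then have avg: "a (m - ?r) - b (m - ?r) * ((\<Sum>e\<in>G. potential (W - e)) / A)
          \<le> (\<Sum>e\<in>G. ln (real (card (matchings E (W - e))))) / A"
        using A0 by (simp add: diff_divide_distrib)
      have b0: "b (m - ?r) \<ge> 0" using b_ge[OF mr'] \<beta>0 by linarith
      have "b (m - ?r) * ((\<Sum>e\<in>G. potential (W - e)) / A)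
          \<le> b (m - ?r) * ((1 + 72 * ?r ^ 4 / m) * \<Phi> + 13 * ?r ^ 4 * real D)"
        using pot b0 unfolding A_def by (rule mult_left_mono)
      also have "\<dots> = b (m - ?r) * (1 + 72 * ?r ^ 4 / m) * \<Phi> + b (m - ?r) * (13 * ?r ^ 4 * real D)"
        by (simp add: algebra_simps)
      also have "b (m - ?r) * (13 * ?r ^ 4 * real D) \<le> noise"
      proof -
        have "(m - ?r) / (\<kappa> * N) \<le> N / (\<kappa> * N)"
          using mN \<kappa>N r2 by (intro divide_right_mono) auto
        then have "(m - ?r) / (\<kappa> * N) \<le> 1 / \<kappa>" using N0 by simp
        then have "((m - ?r) / (\<kappa> * N)) ^ K \<le> (1 / \<kappa>) ^ K"
          using mr \<kappa>N by (intro power_mono) auto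
        then have "b (m - ?r) \<le> \<beta> * (1 / \<kappa>) ^ K"
          unfolding b_def using \<beta>0 by (intro mult_left_mono) auto
        then have "b (m - ?r) \<le> \<beta> / \<kappa> ^ K" by (simp add: power_one_over)
        then show ?thesis unfolding noise_def by (intro mult_right_mono) auto
      qed
      finally have potb: "b (m - ?r) * ((\<Sum>e\<in>G. potential (W - e)) / A)
          \<le> b (m - ?r) * (1 + 72 * ?r ^ 4 / m) * \<Phi> + noise"
        by simp
      \<comment> \<open>By Bernoulli, \<open>(m / (m - r)) ^ K \<ge> 1 + K / m\<close>. In
        \<open>K\<close> the part \<open>72 * r ^ 4\<close> pays for the growth of the potential and
        the extra 1 for the loss \<open>\<beta> * \<Phi> / m\<close> in the logarithm.\<close>
      have b_step: "b (m - ?r) * (1 + 72 * ?r ^ 4 / m) + \<beta> / m \<le> b m"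
      proof -
        have K: "real K = 72 * ?r ^ 4 + 1" by (simp add: K_def)
        have "1 + real K / m \<le> 1 + real K * (?r / (m - ?r))"
        proof -
          have "1 / m \<le> ?r / (m - ?r)" using mr r2 m0 by (intro frac_le) auto
          then have "real K * (1 / m) \<le> real K * (?r / (m - ?r))" by (intro mult_left_mono) auto
          then show ?thesis by simp
        qed
        also have "\<dots> \<le> (1 + ?r / (m - ?r)) ^ K"
        proof (rule Bernoulli_inequality)
          have "0 \<le> ?r / (m - ?r)" using mr by simp
          then show "- 1 \<le> ?r / (m - ?r)" by linarith
        qed
        also have "1 + ?r / (m - ?r) = m / (m - ?r)" using mr by (simp add: field_simps)
        finally have "b (m - ?r) * (1 + real K / m) \<le> b (m - ?r) * (m / (m - ?r)) ^ K"
          using b0 by (intro mult_left_mono) auto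
        also have "\<dots> = b m"
        proof -
          have "(m - ?r) / (\<kappa> * N) * (m / (m - ?r)) = m / (\<kappa> * N)" using mr by simp
          then show ?thesis unfolding b_def mult.assoc power_mult_distrib[symmetric] by simp
        qed
        finally have "b (m - ?r) * (1 + real K / m) \<le> b m" .
        moreover have "b (m - ?r) * (1 + real K / m) = b (m - ?r) * (1 + 72 * ?r ^ 4 / m) + b (m - ?r) / m"
          by (simp add: K add_divide_distrib distrib_left)
        moreover have "\<beta> / m \<le> b (m - ?r) / m" using b_ge[OF mr'] m0 by (intro divide_right_mono) auto
        ultimately show ?thesis by linarith
      qed
      have "(b (m - ?r) * (1 + 72 * ?r ^ 4 / m) + \<beta> / m) * \<Phi> \<le> b m * \<Phi>"
        using b_step \<Phi>0 by (rule mult_right_mono)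
      then have b_step': "b (m - ?r) * (1 + 72 * ?r ^ 4 / m) * \<Phi> + \<beta> * \<Phi> / m \<le> b m * \<Phi>"
        by (simp add: distrib_right)
      have "a m - a (m - ?r) \<le> ln (target m) - (\<eta> + noise)"
      proof -
        have "S m - S (m - ?r) \<le> ln (target m)"
          unfolding S_def target_def N_def[symmetric]
          using edge_size mr N0 D1 by (intro entropy_increment_le) auto
        moreover have "(\<eta> + noise) * m / ?r - (\<eta> + noise) * (m - ?r) / ?r = \<eta> + noise"
          using r2 by (simp add: field_simps)
        ultimately show ?thesis by (simp add: a_def)
      qed
      then have "a m - b m * \<Phi> \<le> ln (real (card (matchings E W)))"
        using lnZ[folded A_def] avg potb b_step' by linarith
      then show ?thesis by (simp add: m_def \<Phi>_def)
    qed
  qed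
  \<comment> \<open>Regularity makes the initial potential zero, so the weight \<open>b N\<close>,
    however large, costs nothing.\<close>
  have "a N \<le> ln (real (card (matchings E V)))"
    using main[of V] by (simp add: potential_V N_def)
  moreover have "a N = N / ?r * (?L - (?r - 1) - (\<eta> + noise + \<kappa> * ?L + ?r * ?L / N))"
    using N0 r2 by (simp add: a_def S_def field_simps)
  \<comment> \<open>Here 117 = 9 * 13; \<open>dmin\<^sup>2\<close> supplies
    \<open>\<kappa> ^ (2 * (r - 1))\<close> and two factors \<open>D\<close>, one of which
    cancels.\<close>
  moreover have "noise = 117 * ?r ^ 5 / (real D * \<eta> * \<kappa> ^ (K + 2 * (r - 1)))"
    using D1 by (simp add: noise_def \<beta>_def dmin_def power_add power_mult power2_eq_square power_mult_distrib
        mult.commute[of 2] field_simps eval_nat_numeral)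
  ultimately show ?thesis by simp
qed

end

section \<open>Stable families and sparse paving matroids\<close>

text \<open>On families of \<open>r\<close>-sets these are the stable sets of the Johnson graph,
  which joins two sets meeting in \<open>r - 1\<close> points. The additive form avoids truncated
  subtraction.\<close>

definition stable :: "nat \<Rightarrow> 'a set set \<Rightarrow> bool" where
  "stable r C \<longleftrightarrow> (\<forall>A\<in>C. \<forall>B\<in>C. A \<noteq> B \<longrightarrow> card (A \<inter> B) + 1 \<noteq> r)"

definition rsubsets :: "'a set \<Rightarrow> nat \<Rightarrow> 'a set set" where
  "rsubsets E r = {X. X \<subseteq> E \<and> card X = r}"

lemma finite_rsubsets [simp]: "finite E \<Longrightarrow> finite (rsubsets E r)"
  by (simp add: rsubsets_def)

text \<open>Two different one-point extensions of \<open>I\<close> would meet exactly in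
  \<open>I\<close>, which has \<open>r - 1\<close> elements.\<close>

lemma stable_unique_extension:
  assumes "stable r C" "C \<subseteq> rsubsets E r" "finite E"
    and "insert y I \<in> C" "insert z I \<in> C" "y \<notin> I" "z \<notin> I"
  shows "y = z"
proof (rule ccontr)
  assume "y \<noteq> z"
  have fin: "finite I"
    using assms by (auto simp: rsubsets_def intro: finite_subset)
  have "card (insert y I) = r" using assms by (auto simp: rsubsets_def)
  then have "card I + 1 = r" using fin assms by simp
  moreover have "insert y I \<inter> insert z I = I" using \<open>y \<noteq> z\<close> assms by auto
  moreover have "insert y I \<noteq> insert z I" using \<open>y \<noteq> z\<close> assms by auto
  ultimately show False using assms unfolding stable_def by metis
qed

text \<open>Every \<open>(r - 1)\<close>-set has at most one extension in \<open>C\<close>. Hence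
  exchanging one point of a member of \<open>C\<close> gives a basis, which yields the circuit and
  hyperplane properties; and of two candidates in a basis exchange at least one succeeds.\<close>

lemma sparse_paving_of_stable:
  assumes fin: "finite E" and r: "1 \<le> r" "r < card E"
    and C: "C \<subseteq> rsubsets E r" "stable r C"
  shows "sparse_paving E r (rsubsets E r - C)"
proof -
  let ?B = "rsubsets E r - C"
  note ext = stable_unique_extension[OF C(2,1) fin]
  have in_B: "insert y I \<in> ?B" if "insert z I \<in> C" "y \<noteq> z" "y \<notin> I" "z \<notin> I" "y \<in> E" for y z I
  proof -
    have I: "finite I" "I \<subseteq> E" "card (insert z I) = r"
      using that C(1) fin by (auto simp: rsubsets_def intro: finite_subset)
    then have "insert y I \<in> rsubsets E r" using that by (simp add: rsubsets_def)
    moreover have "insert y I \<notin> C" using ext[of y I z] that by blast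
    ultimately show ?thesis by blast
  qed
  have swap: "insert e (X - {x}) \<in> ?B" if "X \<in> C" "x \<in> X" "e \<in> E - X" for X x e
    using in_B[of x "X - {x}" e] that by (auto simp: insert_absorb)
  have nonempty: "?B \<noteq> {}"
  proof (cases "C = {}")
    case True
    obtain X where "X \<subseteq> E" "card X = r" using obtain_subset_with_card_n[of r E] r by auto
    then show ?thesis using True by (auto simp: rsubsets_def)
  next
    case False
    then obtain X where X: "X \<in> C" by blast
    then have XE: "X \<subseteq> E" "card X = r" using C by (auto simp: rsubsets_def)
    have "X \<noteq> {}" using XE r by auto
    moreover have "X \<noteq> E" using XE r by auto
    ultimately show ?thesis using swap[OF X] XE by blast
  qed
  have exchange: "\<exists>y\<in>B2 - B1. insert y (B1 - {x}) \<in> ?B"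
    if B: "B1 \<in> ?B" "B2 \<in> ?B" and x: "x \<in> B1 - B2" for B1 B2 x
  proof -
    have B1: "finite B1" "B1 \<subseteq> E" "card B1 = r" and B2: "finite B2" "B2 \<subseteq> E" "card B2 = r"
      using B fin by (auto simp: rsubsets_def intro: finite_subset)
    have card_I: "card (B1 - {x}) + 1 = r" using B1 x r by simp
    have "\<not> B2 \<subseteq> B1" using B1 B2 x card_subset_eq[of B1 B2] by auto
    then obtain y where y: "y \<in> B2 - B1" by blast
    have mem: "insert z (B1 - {x}) \<in> rsubsets E r" if "z \<in> B2 - B1" for z
      using that B1 B2 card_I by (auto simp: rsubsets_def)
    show ?thesis
    proof (cases "\<exists>z\<in>B2 - B1. z \<noteq> y")
      case True
      then obtain z where z: "z \<in> B2 - B1" "z \<noteq> y" by blast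
      have "\<not> (insert y (B1 - {x}) \<in> C \<and> insert z (B1 - {x}) \<in> C)"
        using ext[of y "B1 - {x}" z] y z by blast
      then show ?thesis using mem y z by blast
    next
      case False
      \<comment> \<open>With a single candidate \<open>y\<close> the exchange produces
        \<open>B2\<close> itself.\<close>
      then have "B2 \<subseteq> insert y (B1 - {x})" using x by blast
      moreover have "card (insert y (B1 - {x})) = r" using mem[OF y] by (simp add: rsubsets_def)
      ultimately have "B2 = insert y (B1 - {x})" using B1 B2 by (intro card_subset_eq) auto
      then show ?thesis using B(2) y by auto
    qed
  qed
  have finB: "finite ?B" using fin by simp
  have rank_ge: "card (X \<inter> B) \<le> mrank ?B X" if "B \<in> ?B" for X B
    unfolding mrank_def using finB that by (intro Max_ge) auto
  have rank_le: "mrank ?B X \<le> k" if "\<And>B. B \<in> ?B \<Longrightarrow> card (X \<inter> B) \<le> k" for X k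
    unfolding mrank_def using finB nonempty that by (intro Max.boundedI) auto
  have B_props: "finite B" "B \<subseteq> E" "card B = r" if "B \<in> ?B" for B
    using that fin by (auto simp: rsubsets_def intro: finite_subset)
  have circ: "circuit E ?B X \<and> hyperplane E ?B X" if X: "X \<in> C" for X
  proof
    have XE: "X \<subseteq> E" "card X = r" "finite X"
      using X C fin by (auto simp: rsubsets_def intro: finite_subset)
    have "X \<noteq> E" using XE r by auto
    then obtain e where e: "e \<in> E - X" using XE by blast
    have "X \<noteq> {}" using XE r by auto
    then obtain x where x: "x \<in> X" by blast
    show "circuit E ?B X" unfolding circuit_def
    proof (intro conjI allI impI)
      show "\<not> indep ?B X"
      proof
        assume "indep ?B X"
        then obtain B where B: "B \<in> ?B" "X \<subseteq> B" by (auto simp: indep_def)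
        have "X = B" using B_props[OF B(1)] B(2) XE by (intro card_subset_eq) auto
        then show False using B(1) X by blast
      qed
      fix D assume "D \<subset> X"
      then obtain z where z: "z \<in> X" "D \<subseteq> X - {z}" by blast
      have "insert e (X - {z}) \<in> ?B" using swap[OF X z(1) e] .
      then show "indep ?B D" unfolding indep_def using z by blast
    qed (use XE in simp)
    have rX: "mrank ?B X + 1 = r"
    proof -
      have "mrank ?B X \<le> r - 1"
      proof (rule rank_le)
        fix B assume B: "B \<in> ?B"
        have "X \<noteq> B" using B X by blast
        then have "X \<inter> B \<subset> X" using B_props[OF B] XE card_subset_eq[of B X] by blast
        then have "card (X \<inter> B) < card X" using XE by (intro psubset_card_mono) auto
        then show "card (X \<inter> B) \<le> r - 1" using XE by simp
      qed
      moreover have "r - 1 \<le> mrank ?B X"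
      proof -
        have "X \<inter> insert e (X - {x}) = X - {x}" using e by auto
        then show ?thesis using rank_ge[OF swap[OF X x e], of X] XE x by simp
      qed
      ultimately show ?thesis using r by linarith
    qed
    have rank_full: "mrank ?B Y \<ge> r" if "B \<in> ?B" "B \<subseteq> Y" for B Y
      using rank_ge[OF that(1), of Y] B_props[OF that(1)] that(2) by (simp add: Int_absorb1)
    have "mrank ?B E = r"
    proof (rule antisym)
      show "mrank ?B E \<le> r"
        using B_props by (intro rank_le) (auto simp: Int_absorb1)
      show "r \<le> mrank ?B E" using rank_full[OF swap[OF X x e], of E] XE e by blast
    qed
    moreover have "flat E ?B X" unfolding flat_def
    proof (intro conjI ballI)
      fix f assume f: "f \<in> E - X"
      \<comment> \<open>Adding \<open>f\<close> to \<open>X\<close> gives a set containing the basis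
        \<open>insert f (X - {x})\<close>, so the rank rises.\<close>
      have "r \<le> mrank ?B (insert f X)" using rank_full[OF swap[OF X x f], of "insert f X"] by blast
      then show "mrank ?B X < mrank ?B (insert f X)" using rX by linarith
    qed (use XE in simp)
    ultimately show "hyperplane E ?B X" unfolding hyperplane_def using rX by simp
  qed
  show ?thesis
    unfolding sparse_paving_def matroid_bases_def
  proof (intro conjI ballI allI impI)
    fix X assume "X \<subseteq> E \<and> card X = r"
    then have "X \<in> rsubsets E r" by (simp add: rsubsets_def)
    then show "X \<in> ?B \<or> circuit E ?B X \<and> hyperplane E ?B X" using circ by blast
  qed (fact fin nonempty B_props exchange)+
qed

lemma card_stable_le_s:
  assumes "1 \<le> r" "r < n"
  shows "card {C. C \<subseteq> rsubsets {1..n} r \<and> stable r C} \<le> s n r"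
proof -
  let ?S = "{C. C \<subseteq> rsubsets {1..n} r \<and> stable r C}"
  have "inj_on (\<lambda>C. rsubsets {1..n} r - C) ?S" by (intro inj_onI) blast
  moreover have "(\<lambda>C. rsubsets {1..n} r - C) ` ?S \<subseteq> {\<B>. sparse_paving {1..n} r \<B>}"
    using sparse_paving_of_stable[of "{1..n}" r] assms by auto
  moreover have "finite {\<B>. sparse_paving {1..n} r \<B>}"
    by (rule finite_subset[of _ "Pow (Pow {1..n})"]) (auto simp: sparse_paving_def matroid_bases_def)
  ultimately show ?thesis unfolding s_def by (intro card_inj_on_le)
qed

section \<open>The hypergraph of shadows\<close>

definition shadow :: "'a set \<Rightarrow> 'a set set" where
  "shadow A = (\<lambda>x. A - {x}) ` A"

lemma card_shadow: "finite A \<Longrightarrow> card (shadow A) = card A"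
  unfolding shadow_def by (rule card_image) (auto simp: inj_on_def)

text \<open>Two distinct vertices of a shadow determine the edge, which is the linearity of the
  hypergraph.\<close>

lemma Un_shadow:
  assumes "I \<in> shadow A" "J \<in> shadow A" "I \<noteq> J"
  shows "I \<union> J = A"
  using assms by (auto simp: shadow_def)

text \<open>A left inverse of \<open>shadow\<close>, giving its injectivity. It fails for
  singletons, whose shadow is \<open>{{}}\<close>.\<close>

lemma Union_shadow:
  assumes "card A \<ge> 2"
  shows "\<Union>(shadow A) = A"
proof -
  have fin: "finite A" using assms card.infinite by fastforce
  obtain a b where "a \<in> A" "b \<in> A" "a \<noteq> b"
    using assms card_le_Suc0_iff_eq[OF fin] by fastforce
  then show ?thesis by (auto simp: shadow_def)
qed

lemma mem_shadow_iff:
  assumes "finite A"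
  shows "I \<in> shadow A \<longleftrightarrow> I \<subseteq> A \<and> card I + 1 = card A"
proof
  assume "I \<in> shadow A"
  then show "I \<subseteq> A \<and> card I + 1 = card A"
    using assms card_Suc_Diff1 by (fastforce simp: shadow_def)
next
  assume I: "I \<subseteq> A \<and> card I + 1 = card A"
  then have "card (A - I) = card A - card I"
    using assms finite_subset[of I A] by (simp add: card_Diff_subset)
  then have "card (A - I) = 1" using I by linarith
  then obtain x where "A - I = {x}" by (auto simp: card_1_singleton_iff)
  then have "x \<in> A" "I = A - {x}" using I by auto
  then show "I \<in> shadow A" by (auto simp: shadow_def)
qed

text \<open>Supplies the condition that the degree is at most the number of vertices.\<close>

lemma binomial_ge_diff: "1 \<le> k \<Longrightarrow> k \<le> n \<Longrightarrow> n - k + 1 \<le> n choose k"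
proof (induction n)
  case (Suc n)
  show ?case
  proof (cases "k = Suc n")
    case False
    then have IH: "n - k + 1 \<le> n choose k" using Suc by simp
    obtain j where j: "k = Suc j" using Suc.prems by (cases k) auto
    have "n choose j \<ge> 1" using j Suc.prems False by (simp add: Suc_le_eq)
    then show ?thesis using IH j False Suc.prems by simp
  qed simp
qed simp

lemma shadow_hypergraph:
  assumes r: "2 \<le> r" "r \<le> n"
  shows "regular_linear_hypergraph (rsubsets {1..n} (r - 1)) (shadow ` rsubsets {1..n} r) r (n - r + 1)"
proof
  let ?R = "rsubsets {1..n} r" and ?V = "rsubsets {1..n} (r - 1)"
  have fin: "finite A" if "A \<in> ?R" for A using that by (auto simp: rsubsets_def intro: finite_subset)
  have inj: "inj_on shadow ?R"
  proof (rule inj_onI)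
    fix A B assume AB: "A \<in> ?R" "B \<in> ?R" "shadow A = shadow B"
    then have "card A \<ge> 2" "card B \<ge> 2" using r by (simp_all add: rsubsets_def)
    then show "A = B" using AB(3) by (metis Union_shadow)
  qed
  show "finite ?V" by simp
  show "r \<ge> 2" by (rule r)
  show "e \<subseteq> ?V" if e: "e \<in> shadow ` ?R" for e
  proof
    fix I assume "I \<in> e"
    then obtain A where A: "A \<in> ?R" "I \<in> shadow A" using e by blast
    then have "I \<subseteq> A" "card I + 1 = card A" using mem_shadow_iff[OF fin] by blast+
    then show "I \<in> ?V" using A by (auto simp: rsubsets_def)
  qed
  show "card e = r" if e: "e \<in> shadow ` ?R" for e
  proof -
    obtain A where A: "A \<in> ?R" "e = shadow A" using e by blast
    then show ?thesis using card_shadow[OF fin[OF A(1)]] by (simp add: rsubsets_def)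
  qed
  show "e = f" if ef: "e \<in> shadow ` ?R" "f \<in> shadow ` ?R" "x \<in> e \<inter> f" "y \<in> e \<inter> f" "x \<noteq> y" for e f x y
  proof -
    obtain A B where AB: "e = shadow A" "f = shadow B" using ef by blast
    have "A = x \<union> y" "B = x \<union> y" using Un_shadow[of x _ y] ef AB by blast+
    then show ?thesis using AB by simp
  qed
  show "hdeg (shadow ` ?R) I = real (n - r + 1)" if I: "I \<in> ?V" for I
  proof -
    have I': "finite I" "I \<subseteq> {1..n}" "card I = r - 1"
      using I by (auto simp: rsubsets_def intro: finite_subset)
    have "{f \<in> shadow ` ?R. I \<in> f} = shadow ` (\<lambda>y. insert y I) ` ({1..n} - I)"
    proof (intro equalityI subsetI)
      fix f assume "f \<in> {f \<in> shadow ` ?R. I \<in> f}"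
      then obtain A where A: "A \<in> ?R" "f = shadow A" "I \<in> shadow A" by blast
      then obtain y where "y \<in> A" "I = A - {y}" by (auto simp: shadow_def)
      then have "A = insert y I" "y \<in> {1..n} - I" using A by (auto simp: rsubsets_def)
      then show "f \<in> shadow ` (\<lambda>y. insert y I) ` ({1..n} - I)" using A by blast
    next
      fix f assume "f \<in> shadow ` (\<lambda>y. insert y I) ` ({1..n} - I)"
      then obtain y where y: "y \<in> {1..n} - I" "f = shadow (insert y I)" by blast
      have "insert y I \<in> ?R" using y I' r by (auto simp: rsubsets_def)
      moreover have "I \<in> shadow (insert y I)" using y I' by (subst mem_shadow_iff) auto
      ultimately show "f \<in> {f \<in> shadow ` ?R. I \<in> f}" using y by blast
    qed
    moreover have "card (shadow ` (\<lambda>y. insert y I) ` ({1..n} - I)) = card ((\<lambda>y. insert y I) ` ({1..n} - I))"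
      using I' r by (intro card_image inj_on_subset[OF inj]) (auto simp: rsubsets_def)
    moreover have "card ((\<lambda>y. insert y I) ` ({1..n} - I)) = card ({1..n} - I)"
      by (intro card_image inj_onI) auto
    moreover have "card ({1..n} - I) = n - r + 1" using I' r by (simp add: card_Diff_subset)
    ultimately show ?thesis by (simp add: hdeg_def)
  qed
  show "n - r + 1 \<ge> 1" by simp
  show "n - r + 1 \<le> card ?V"
  proof -
    have "n - (r - 1) + 1 \<le> n choose (r - 1)" using r by (intro binomial_ge_diff) auto
    moreover have "n - r + 1 \<le> n - (r - 1) + 1" using r by linarith
    ultimately show ?thesis by (simp add: rsubsets_def n_subsets)
  qed
qed

text \<open>Two \<open>r\<close>-sets meeting in \<open>r - 1\<close> points have their intersection
  in both shadows, so sets with pairwise disjoint shadows form a stable family.\<close>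

lemma card_matchings_le_s:
  assumes r: "2 \<le> r" "r < n"
  shows "card (matchings (shadow ` rsubsets {1..n} r) (rsubsets {1..n} (r - 1))) \<le> s n r"
proof -
  let ?R = "rsubsets {1..n} r"
  let ?M = "matchings (shadow ` ?R) (rsubsets {1..n} (r - 1))"
  define \<phi> where "\<phi> M = {A \<in> ?R. shadow A \<in> M}" for M
  have fin: "finite A" "card A = r" if "A \<in> ?R" for A
    using that by (auto simp: rsubsets_def intro: finite_subset)
  have "inj_on \<phi> ?M"
  proof (rule inj_on_inverseI)
    fix M assume "M \<in> ?M"
    then show "shadow ` \<phi> M = M" by (auto simp: \<phi>_def matchings_def)
  qed
  moreover have "\<phi> ` ?M \<subseteq> {C. C \<subseteq> ?R \<and> stable r C}"
  proof -
    have "stable r (\<phi> M)" if M: "M \<in> ?M" for M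
      unfolding stable_def
    proof (intro ballI impI notI)
      fix A B assume AB: "A \<in> \<phi> M" "B \<in> \<phi> M" "A \<noteq> B" and card: "card (A \<inter> B) + 1 = r"
      have R: "A \<in> ?R" "B \<in> ?R" using AB by (auto simp: \<phi>_def)
      have "A \<inter> B \<in> shadow A" "A \<inter> B \<in> shadow B"
        using card fin[OF R(1)] fin[OF R(2)] by (auto simp: mem_shadow_iff)
      \<comment> \<open>Disjointness in a matching concerns distinct edges only, so distinct sets
        must have distinct shadows.\<close>
      moreover have "shadow A \<noteq> shadow B"
      proof
        assume "shadow A = shadow B"
        moreover have "card A \<ge> 2" "card B \<ge> 2" using r(1) fin(2)[OF R(1)] fin(2)[OF R(2)] by simp_all
        ultimately show False using AB(3) by (metis Union_shadow)
      qed
      then have "disjnt (shadow A) (shadow B)"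
        using AB M by (auto simp: \<phi>_def matchings_def pairwise_def)
      ultimately show False by (auto simp: disjnt_def)
    qed
    then show ?thesis by (auto simp: \<phi>_def)
  qed
  moreover have "finite {C. C \<subseteq> ?R \<and> stable r C}"
    by (rule finite_subset[of _ "Pow ?R"]) auto
  ultimately have "card ?M \<le> card {C. C \<subseteq> ?R \<and> stable r C}" by (intro card_inj_on_le)
  then show ?thesis using card_stable_le_s[of r n] r by linarith
qed

section \<open>Choice of parameters and asymptotics\<close>

text \<open>The parameters of the counting theorem are chosen as \<open>\<eta> = D powr (- 1 / 2)\<close> and as the
  \<open>\<kappa>\<close> with \<open>\<kappa> ^ (K + 2 * (r - 1)) = D powr (- 1 / 4)\<close>.\<close>

definition error :: "nat \<Rightarrow> real \<Rightarrow> real" where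
  "error r x = x powr (- (1 / 2)) + 117 * real r ^ 5 * x powr (- (1 / 4))
     + x powr (- (1 / (4 * real (72 * r ^ 4 + 1 + 2 * (r - 1))))) * ln x + real r * (x powr (- 1) * ln x)"

lemma error_tendsto_0: "(error r \<longlongrightarrow> 0) at_top"
proof -
  have "(error r \<longlongrightarrow> 0 + 0 + 0 + 0) at_top"
    unfolding error_def
  proof (intro tendsto_add tendsto_mult_right_zero powr_neg_times_ln_tendsto_0)
    show "((\<lambda>x. x powr (- (1 / 2))) \<longlongrightarrow> 0) (at_top :: real filter)"
      by (intro tendsto_neg_powr filterlim_ident) auto
    show "((\<lambda>x. x powr (- (1 / 4))) \<longlongrightarrow> 0) (at_top :: real filter)"
      by (intro tendsto_neg_powr filterlim_ident) auto
  qed (auto intro!: add_pos_nonneg)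
  then show ?thesis by simp
qed

text \<open>The hypothesis on \<open>x\<close> is the condition
  \<open>4 * \<eta> * ln D \<le> r\<close> for the chosen \<eta>.\<close>

lemma ln_s_ge:
  assumes r: "2 \<le> r" "r < n"
  defines "x \<equiv> real (n - r + 1)"
  assumes small: "4 * (x powr (- (1 / 2)) * ln x) \<le> real r"
  shows "real (n choose (r - 1)) / real r * (ln x - (real r - 1) - error r x) \<le> ln (real (s n r))"
proof -
  let ?V = "rsubsets {1..n} (r - 1)" and ?E = "shadow ` rsubsets {1..n} r"
  interpret regular_linear_hypergraph ?V ?E r "n - r + 1"
    using r by (intro shadow_hypergraph) auto
  define P where "P = 72 * r ^ 4 + 1 + 2 * (r - 1)"
  define \<kappa> where "\<kappa> = x powr (- (1 / (4 * real P)))"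
  define \<eta> where "\<eta> = x powr (- (1 / 2))"
  define N where "N = real (card ?V)"
  have N: "N = real (n choose (r - 1))" by (simp add: N_def rsubsets_def n_subsets)
  have x1: "x \<ge> 1" by (simp add: x_def)
  have P0: "P > 0" by (simp add: P_def)
  have xN: "x \<le> N" using degree_le by (simp add: x_def N_def)
  have \<kappa>P: "\<kappa> ^ P = x powr (- (1 / 4))"
    using x1 P0 by (simp add: \<kappa>_def powr_power)
  \<comment> \<open>The denominator is \<open>x\<close> to the power 1 - 1/2 - 1/4 = 1/4.\<close>
  have "117 * real r ^ 5 / (x * \<eta> * \<kappa> ^ P) = 117 * real r ^ 5 * x powr (- (1 / 4))"
  proof -
    have "x * \<eta> * \<kappa> ^ P = x powr 1 * x powr (- (1 / 2)) * x powr (- (1 / 4))"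
      using x1 by (simp add: \<eta>_def \<kappa>P)
    also have "\<dots> = x powr (1 + - (1 / 2) + - (1 / 4))" by (simp only: powr_add)
    also have "1 + - (1 / 2) + - (1 / 4) = (1 / 4 :: real)" by simp
    finally show ?thesis by (simp add: powr_minus_divide)
  qed
  moreover have "real r * ln x / N \<le> real r * (x powr (- 1) * ln x)"
  proof -
    have "real r * ln x / N \<le> real r * ln x / x"
      using xN x1 by (intro divide_left_mono) auto
    then show ?thesis using x1 by (simp add: powr_neg_one)
  qed
  ultimately have "\<eta> + 117 * real r ^ 5 / (x * \<eta> * \<kappa> ^ P) + \<kappa> * ln x + real r * ln x / N \<le> error r x"
    by (simp add: error_def \<eta>_def \<kappa>_def P_def)
  then have "N / real r * (ln x - (real r - 1) - error r x)
      \<le> N / real r * (ln x - (real r - 1)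
        - (\<eta> + 117 * real r ^ 5 / (x * \<eta> * \<kappa> ^ P) + \<kappa> * ln x + real r * ln x / N))"
    by (intro mult_left_mono) (auto simp: N_def)
  also have "\<dots> \<le> ln (real (card (matchings ?E ?V)))"
    unfolding P_def N_def x_def
    using x1 small by (intro ln_card_matchings_ge) (auto simp: \<kappa>_def \<eta>_def x_def)
  also have "\<dots> \<le> ln (real (s n r))"
    using card_matchings_le_s[OF r] card_matchings_pos[of ?V] by (subst ln_le_cancel_iff) auto
  finally show ?thesis by (simp add: N)
qed

text \<open>A family consisting of one singleton is vacuously stable; it corresponds to the matroid
  with exactly one loop. This settles rank one, where the required bound is \<open>log n\<close>
  with zero error.\<close>

lemma s_1_ge:
  assumes "n \<ge> 2"
  shows "n \<le> s n 1"
proof -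
  let ?S = "{C. C \<subseteq> rsubsets {1..n} 1 \<and> stable 1 C}"
  have "inj_on (\<lambda>x. {{x}}) {1..n}" by (auto simp: inj_on_def)
  moreover have "(\<lambda>x. {{x}}) ` {1..n} \<subseteq> ?S" by (auto simp: stable_def rsubsets_def)
  moreover have "finite ?S" by (rule finite_subset[of _ "Pow (rsubsets {1..n} 1)"]) auto
  ultimately have "card {1..n} \<le> card ?S" by (rule card_inj_on_le)
  then show ?thesis using card_stable_le_s[of 1 n] assms by simp
qed

theorem theorem2p3:
  fixes r :: nat
  assumes "r \<ge> 1"
  shows "\<exists>\<epsilon> :: nat \<Rightarrow> real. \<epsilon> \<longlonglongrightarrow> 0 \<and>
    (\<forall>\<^sub>F n in sequentially.
       log 2 (real (s n r)) \<ge>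
         (1 / (real n - real r + 1)) * real (n choose r) *
           log 2 (exp (1 - real r) * (real n - real r + 1) * (1 + \<epsilon> n)))"
proof (cases "r = 1")
  case True
  have "\<forall>\<^sub>F n in sequentially. log 2 (real (s n r)) \<ge>
      (1 / (real n - real r + 1)) * real (n choose r) *
        log 2 (exp (1 - real r) * (real n - real r + 1) * (1 + (\<lambda>_. 0) n))"
    using eventually_ge_at_top[of 2]
  proof eventually_elim
    case (elim n)
    then show ?case using s_1_ge[OF elim] True by simp
  qed
  then show ?thesis using tendsto_const by (intro exI[of _ "\<lambda>_. 0"]) auto
next
  case False
  then have r: "r \<ge> 2" using assms by simp
  define x where "x n = real (n - r + 1)" for n
  \<comment> \<open>Chosen so that \<open>ln (1 + \<epsilon> n)\<close> is exactly minus the error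
    term.\<close>
  define \<epsilon> where "\<epsilon> n = exp (- error r (x n)) - 1" for n
  have x_lim: "filterlim x at_top sequentially"
    unfolding x_def
    by (intro filterlim_compose[OF filterlim_real_sequentially] filterlim_at_top_mono[OF filterlim_minus_const_nat_at_top[of r]])
      (auto intro: always_eventually)
  have "(\<lambda>n. exp (- error r (x n)) - 1) \<longlonglongrightarrow> exp (- 0) - 1"
    by (intro tendsto_intros filterlim_compose[OF error_tendsto_0 x_lim])
  then have "\<epsilon> \<longlonglongrightarrow> 0" by (simp add: \<epsilon>_def[abs_def])
  moreover have "\<forall>\<^sub>F n in sequentially. log 2 (real (s n r)) \<ge>
      (1 / (real n - real r + 1)) * real (n choose r) *
        log 2 (exp (1 - real r) * (real n - real r + 1) * (1 + \<epsilon> n))"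
  proof -
    have "((\<lambda>y::real. 4 * (y powr (- (1 / 2)) * ln y)) \<longlongrightarrow> 0) at_top"
      by (intro tendsto_mult_right_zero powr_neg_times_ln_tendsto_0) simp
    then have "(\<lambda>n. 4 * (x n powr (- (1 / 2)) * ln (x n))) \<longlonglongrightarrow> 0"
      using x_lim by (rule filterlim_compose)
    then have "\<forall>\<^sub>F n in sequentially. 4 * (x n powr (- (1 / 2)) * ln (x n)) < real r"
      by (rule order_tendstoD(2)) (use r in simp)
    then show ?thesis using eventually_gt_at_top[of r]
    proof eventually_elim
      case (elim n)
      have x: "real n - real r + 1 = x n" and x1: "x n \<ge> 1" using elim by (auto simp: x_def of_nat_diff)
      \<comment> \<open>Both sides are the size of a perfect matching, were one to exist; this
        translates the vertex count \<open>n choose (r - 1)\<close> into the normalisation of the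
        claim.\<close>
      have binom: "(1 / x n) * real (n choose r) = real (n choose (r - 1)) / real r"
      proof -
        have "r * (n choose r) = (n - r + 1) * (n choose (r - 1))"
          using Suc_times_binomial_add[of "r - 1" "n - r"] r elim by simp
        then have "real (r * (n choose r)) = real ((n - r + 1) * (n choose (r - 1)))" by (rule arg_cong)
        then have "real r * real (n choose r) = x n * real (n choose (r - 1))" by (simp only: of_nat_mult x_def)
        then show ?thesis using x1 r by (simp add: field_simps)
      qed
      have "exp (1 - real r) * x n * (1 + \<epsilon> n) = exp (1 - real r) * exp (ln (x n)) * exp (- error r (x n))"
        using x1 by (simp add: \<epsilon>_def)
      also have "\<dots> = exp (ln (x n) - (real r - 1) - error r (x n))"
        by (simp add: exp_add[symmetric] algebra_simps)
      finally have "log 2 (exp (1 - real r) * x n * (1 + \<epsilon> n)) = (ln (x n) - (real r - 1) - error r (x n)) / ln 2"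
        by (simp add: log_def)
      moreover have "real (n choose (r - 1)) / real r * (ln (x n) - (real r - 1) - error r (x n)) / ln 2
          \<le> ln (real (s n r)) / ln 2"
        using elim r unfolding x_def by (intro divide_right_mono ln_s_ge) auto
      ultimately show ?case unfolding x binom by (simp add: log_def)
    qed
  qed
  ultimately show ?thesis by blast
qed

end
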